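(* If $q_1, q_2 \in L^{\infty}(\Omega)$ are such that $\mathcal{C}(q_1) = \mathcal{C}(q_2)$, then $q_1 = q_2$.
   Context: Let $d\in\{2,3\}$. Let $\Omega\subset\mathbb{R}^d$ be a bounded, open domain with $\mathbf{0}\in\Omega$ such that $\mathbb{R}^d\setminus\overline{\Omega}$ is connected, and let $\mathbb{M}\subset\mathbb{R}^d\setminus\overline{\Omega}$ be a bounded, open domain. Let $k>0$ be the wavenumber and let $\mathbf{m}\in\mathbb{R}^d$ be the Mach vector, with $|\mathbf{m}|<1$. Put $\beta:=\sqrt{1-|\mathbf{m}|^2}$ and $|\mathbf{x}|_{\mathbf{m}}:=\sqrt{(\mathbf{x}\cdot\mathbf{m})^2+\beta^2|\mathbf{x}|^2}$ for $\mathbf{x}\in\mathbb{R}^d$. The free field Green's function of the convected Helmholtz equation $(k+i\mathbf{m}\cdot\nabla)^2p+\Delta p=-Q$ is, for $\mathbf{x}\neq\mathbf{y}$, $$g(\mathbf{x},\mathbf{y})=\frac{\exp\left(\frac{ik}{\beta^2}\left(-(\mathbf{x}-\mathbf{y})\cdot\mathbf{m}+|\mathbf{x}-\mathbf{y}|_{\mathbf{m}}\right)\right)}{4\pi|\mathbf{x}-\mathbf{y}|_{\mathbf{m}}}\quad (d=3),$$ $$g(\mathbf{x},\mathbf{y})=\frac{i}{4\beta}\exp\left(-\frac{ik}{\beta^2}(\mathbf{x}-\mathbf{y})\cdot\mathbf{m}\right)H^{(1)}_0\left(\frac{k}{\beta^2}|\mathbf{x}-\mathbf{y}|_{\mathbf{m}}\right)\quad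 (d=2),$$ where $H^{(1)}_0$ is the Hankel function of the first kind of order $0$. For $q\in L^2(\Omega)$ (in particular for $q\in L^\infty(\Omega)$) let $c_q(\mathbf{x}_1,\mathbf{x}_2):=\int_\Omega g(\mathbf{x}_1,\mathbf{y})\,q(\mathbf{y})\,\overline{g(\mathbf{x}_2,\mathbf{y})}\,d\mathbf{y}$ for $\mathbf{x}_1,\mathbf{x}_2\in\mathbb{M}$. The operator $\mathcal{C}(q):L^2(\mathbb{M})\to L^2(\mathbb{M})$ is the integral operator $(\mathcal{C}(q)\varphi)(\mathbf{x}_1):=\int_{\mathbb{M}}c_q(\mathbf{x}_1,\mathbf{x}_2)\varphi(\mathbf{x}_2)\,d\mathbf{x}_2$. All function spaces are spaces of complex-valued functions; elements of $L^\infty(\Omega)$ are identified when equal almost everywhere. *)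

theory Defs
  imports "HOL-Analysis.Analysis"
begin

definition bessel_J0 :: "real \<Rightarrow> real" where
  "bessel_J0 r = (\<Sum>n. (-1) ^ n * (r / 2) ^ (2 * n) / (fact n)\<^sup>2)"

text \<open>Bessel function of the second kind of order 0, for positive arguments, by its standard
  expansion with the harmonic numbers and the Euler-Mascheroni constant.\<close>

definition bessel_Y0 :: "real \<Rightarrow> real" where
  "bessel_Y0 r =
     2 / pi * ((ln (r / 2) + euler_mascheroni) * bessel_J0 r
       - (\<Sum>n. (-1) ^ n * harm n * (r / 2) ^ (2 * n) / (fact n)\<^sup>2))"

definition hankel1_0 :: "real \<Rightarrow> complex" where
  "hankel1_0 r = complex_of_real (bessel_J0 r) + \<i> * complex_of_real (bessel_Y0 r)"

definition mach_beta :: "real ^ 'n \<Rightarrow> real" where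
  "mach_beta m = sqrt (1 - (norm m)\<^sup>2)"

definition mach_norm :: "real ^ 'n \<Rightarrow> real ^ 'n \<Rightarrow> real" where
  "mach_norm m x = sqrt ((x \<bullet> m)\<^sup>2 + (mach_beta m)\<^sup>2 * (norm x)\<^sup>2)"

text \<open>The free field Green's function in dimension \<open>CARD('n)\<close>. Only the dimensions 2 and 3 are
  meaningful; the value for \<open>x = y\<close> is irrelevant.\<close>

definition convected_green ::
  "real \<Rightarrow> real ^ 'n \<Rightarrow> real ^ 'n \<Rightarrow> real ^ 'n \<Rightarrow> complex" where
  "convected_green k m x y =
     (if CARD('n) = 3 then
        exp (\<i> * complex_of_real (k / (mach_beta m)\<^sup>2 * (- ((x - y) \<bullet> m) + mach_norm m (x - y))))
          / complex_of_real (4 * pi * mach_norm m (x - y))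
      else
        \<i> / complex_of_real (4 * mach_beta m)
          * exp (- \<i> * complex_of_real (k / (mach_beta m)\<^sup>2 * ((x - y) \<bullet> m)))
          * hankel1_0 (k / (mach_beta m)\<^sup>2 * mach_norm m (x - y)))"

text \<open>Elements of the Lebesgue spaces are represented by functions; equality in
  these spaces is equality almost everywhere with respect to \<open>lebesgue_on S\<close>.\<close>

definition L2_fun :: "'a::euclidean_space set \<Rightarrow> ('a \<Rightarrow> complex) set" where
  "L2_fun S = {f \<in> borel_measurable (lebesgue_on S).
     integrable (lebesgue_on S) (\<lambda>x. (cmod (f x))\<^sup>2)}"

definition Linf_fun :: "'a::euclidean_space set \<Rightarrow> ('a \<Rightarrow> complex) set" where
  "Linf_fun S = {f \<in> borel_measurable (lebesgue_on S).
     \<exists>B. AE x in lebesgue_on S. cmod (f x) \<le> B}"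

definition cov_kernel ::
  "real \<Rightarrow> real ^ 'n \<Rightarrow> (real ^ 'n) set \<Rightarrow> (real ^ 'n \<Rightarrow> complex)
     \<Rightarrow> real ^ 'n \<Rightarrow> real ^ 'n \<Rightarrow> complex" where
  "cov_kernel k m \<Omega> q x1 x2 =
     (LINT y|lebesgue_on \<Omega>. convected_green k m x1 y * q y * cnj (convected_green k m x2 y))"

definition cov_operator ::
  "real \<Rightarrow> real ^ 'n \<Rightarrow> (real ^ 'n) set \<Rightarrow> (real ^ 'n) set \<Rightarrow> (real ^ 'n \<Rightarrow> complex)
     \<Rightarrow> (real ^ 'n \<Rightarrow> complex) \<Rightarrow> real ^ 'n \<Rightarrow> complex" where
  "cov_operator k m \<Omega> M q \<phi> x1 = (LINT x2|lebesgue_on M. cov_kernel k m \<Omega> q x1 x2 * \<phi> x2)"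

end

theory Submission
  imports Defs "HOL-Complex_Analysis.Complex_Analysis" "HOL-Real_Asymp.Real_Asymp"
begin

text \<open>
  Put \<open>q = q1 - q2\<close>. Testing the operator with its own conjugated kernel shows that the covariance
  \<open>\<integral> g x1 y * q y * cnj (g x2 y)\<close> vanishes for \<open>x1\<close>, \<open>x2\<close> in a ball of \<open>M\<close>. In \<open>x1\<close> it is a
  volume potential, hence real analytic along lines off \<open>closure \<Omega>\<close>, so that it vanishes on the
  whole connected complement. Letting \<open>x1\<close> tend to infinity in a direction \<open>\<omega>\<close> replaces \<open>g x1 y\<close>
  by a plane wave, and doing the same with \<open>x2\<close> shows that the Fourier transform of \<open>q\<close> vanishes
  at all differences of two wave vectors. These fill a neighbourhood of the origin; since \<open>q\<close> has
  bounded support its Fourier transform is entire, and \<open>q = 0\<close> almost everywhere.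

  The far field only needs \<open>g x1 y\<close> to behave like \<open>a * exp (\<i> * s) + b * exp (- \<i> * s)\<close> times a
  power of the scaled distance \<open>s\<close>, with \<open>(a, b) \<noteq> (0, 0)\<close>. In dimension 2 this follows from the
  Bessel differential equation, and the exact asymptotics of the Hankel function (that is,
  \<open>b = 0\<close>) is not needed.
\<close>

section \<open>The Hankel function near and at infinity\<close>

text \<open>Both dimensions are one case: off the diagonal the Green's function is a unimodular
  convective phase times \<open>G\<close> of the squared Mach distance, with \<open>G\<close>
  holomorphic on the right half-plane. The square matters: along a line it is a quadratic polynomial
  in the parameter, so complex parameters can be inserted, and one-variable continuation on short
  segments suffices. The convective phase does no harm, because the second factor of the covariance
  is conjugated: in the product of the two far fields the phases
  \<open>cis (\<kappa> * (y \<bullet> m))\<close> cancel and the difference of the wave vectors is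
  left. For this both limits must use the same sign, outgoing or incoming, so the sign is fixed once
  from \<open>a\<close> and \<open>b\<close>. In the geometry of \<open>mach_norm\<close> the
  directions form a unit sphere, whose differences fill a ball of radius 2 as soon as the dimension
  is at least 2. A further obstacle is that \<open>M\<close> may touch the boundary of \<Omega>,
  where the covariance is not controlled; the operator is therefore tested on a compact ball inside
  \<open>M\<close>.\<close>

lemma summable_powser_fact_bound:
  fixes c :: "nat \<Rightarrow> complex"
  assumes "\<And>n. cmod (c n) \<le> B / fact n"
  shows "summable (\<lambda>n. c n * z ^ n)"
proof (rule summable_comparison_test')
  show "summable (\<lambda>n. B * (inverse (fact n) * cmod z ^ n))"
    by (intro summable_mult summable_exp)
  show "norm (c n * z ^ n) \<le> B * (inverse (fact n) * cmod z ^ n)" if "n \<ge> 0" for n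
    using mult_right_mono[OF assms[of n], of "cmod z ^ n"]
    by (simp add: norm_mult norm_power field_simps)
qed

section \<open>Power series in \<open>z = (r / 2)^2\<close> behind the Bessel functions of order
  0\<close>

definition J_coeff :: "nat \<Rightarrow> complex" where
  "J_coeff n = (-1) ^ n / (fact n)\<^sup>2"

definition Y_coeff :: "nat \<Rightarrow> complex" where
  "Y_coeff n = (-1) ^ n * harm n / (fact n)\<^sup>2"

lemma square_le_fact: "(real n)\<^sup>2 \<le> 2 * fact n"
proof -
  have "n\<^sup>2 \<le> 2 * fact n"
  proof (induction n)
    case (Suc n)
    show ?case
    proof (cases n)
      case (Suc k)
      then have "Suc n \<le> 2 * fact n"
        using fact_ge_self[of n] by linarith
      then have "Suc n * Suc n \<le> Suc n * (2 * fact n)" by (rule mult_left_mono) simp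
      then show ?thesis by (simp add: power2_eq_square)
    qed simp
  qed simp
  then have "real (n\<^sup>2) \<le> real (2 * fact n)" by (rule of_nat_mono)
  then show ?thesis by simp
qed

lemma harm_le: "harm n \<le> real n"
proof (induction n)
  case (Suc n)
  have "inverse (real (Suc n)) \<le> 1" by (simp add: field_simps)
  then show ?case using Suc by (simp add: harm_Suc)
qed (simp add: harm_def)

text \<open>One factor \<open>fact n\<close> of the denominator absorbs \<open>n\<close>,
  \<open>harm n\<close> and \<open>n * harm n\<close>, all of which are at most
  \<open>2 * fact n\<close>; the other is left for comparison with the exponential series. The
  versions multiplied by \<open>n\<close> serve the Euler derivatives below.\<close>

lemma cmod_coeff_le:
  "cmod (J_coeff n) \<le> 2 / fact n" "cmod (of_nat n * J_coeff n) \<le> 2 / fact n"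
  "cmod (Y_coeff n) \<le> 2 / fact n" "cmod (of_nat n * Y_coeff n) \<le> 2 / fact n"
proof -
  have aux: "cmod (of_real x * ((-1) ^ n / (fact n)\<^sup>2)) \<le> 2 / fact n"
    if "0 \<le> x" "x \<le> 2 * fact n" for x :: real
  proof -
    have "cmod (of_real x * ((-1) ^ n / (fact n)\<^sup>2)) = x / (fact n)\<^sup>2"
      using that by (simp add: norm_mult norm_divide norm_power)
    also have "\<dots> \<le> 2 * fact n / (fact n)\<^sup>2"
      using that by (intro divide_right_mono) auto
    finally show ?thesis by (simp add: power2_eq_square)
  qed
  have n: "real n \<le> 2 * fact n"
    using square_le_fact[of n] fact_ge_self[of n]
    by (metis fact_ge_zero mult_2 of_nat_fact of_nat_le_iff add_increasing)
  have hh: "(harm n :: complex) = of_real (harm n)" by (simp add: of_real_harm)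
  have h0: "0 \<le> (harm n :: real)" by (rule harm_nonneg)
  show "cmod (J_coeff n) \<le> 2 / fact n"
    using aux[of 1] fact_ge_1[of n, where 'a = real] by (simp add: J_coeff_def)
  show "cmod (of_nat n * J_coeff n) \<le> 2 / fact n"
    using aux[of "real n"] n by (simp add: J_coeff_def)
  show "cmod (Y_coeff n) \<le> 2 / fact n"
    using aux[of "harm n"] n h0 harm_le[of n] by (simp add: Y_coeff_def hh mult_ac)
  have "real n * harm n \<le> (real n)\<^sup>2"
    unfolding power2_eq_square using harm_le[of n] by (intro mult_left_mono) auto
  then show "cmod (of_nat n * Y_coeff n) \<le> 2 / fact n"
    using aux[of "real n * harm n"] square_le_fact[of n] h0 
    by (simp add: Y_coeff_def hh mult_ac)
qed

lemmas summable_coeff = cmod_coeff_le[THEN summable_powser_fact_bound]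

definition J_ser :: "complex \<Rightarrow> complex" where
  "J_ser z = (\<Sum>n. J_coeff n * z ^ n)"

definition Y_ser :: "complex \<Rightarrow> complex" where
  "Y_ser z = (\<Sum>n. Y_coeff n * z ^ n)"

text \<open>Euler derivative \<open>z * d/dz\<close> of \<open>J_ser\<close>. In the variable
  \<open>z\<close> the Bessel equation of order 0 is the first-order system for a function and this
  derivative (\<open>J_ser_deriv\<close>, \<open>J_ser_eul_deriv\<close>).\<close>

definition J_ser_eul :: "complex \<Rightarrow> complex" where
  "J_ser_eul z = (\<Sum>n. of_nat n * J_coeff n * z ^ n)"

definition Y_ser_eul :: "complex \<Rightarrow> complex" where
  "Y_ser_eul z = (\<Sum>n. of_nat n * Y_coeff n * z ^ n)"

lemma powser_euler:
  fixes c :: "nat \<Rightarrow> complex"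
  assumes "\<And>z. summable (\<lambda>n. c n * z ^ n)" "\<And>z. summable (\<lambda>n. of_nat n * c n * z ^ n)"
    "z \<noteq> 0"
  shows "((\<lambda>z. \<Sum>n. c n * z ^ n) has_field_derivative (\<Sum>n. of_nat n * c n * z ^ n) / z) (at z)"
proof -
  have s: "summable (\<lambda>n. diffs c n * z ^ n)"
    using termdiff_converges_all assms(1) by blast
  have "(\<Sum>n. of_nat n * c n * z ^ n) = (\<Sum>n. of_nat (Suc n) * c (Suc n) * z ^ Suc n)"
    using suminf_split_head[OF assms(2)[of z]] by simp
  also have "\<dots> = (\<Sum>n. z * (diffs c n * z ^ n))"
    by (simp add: diffs_def algebra_simps)
  also have "\<dots> = z * (\<Sum>n. diffs c n * z ^ n)"
    by (rule suminf_mult[OF s])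
  finally have "(\<Sum>n. of_nat n * c n * z ^ n) / z = (\<Sum>n. diffs c n * z ^ n)"
    using assms(3) by simp
  then show ?thesis
    using termdiffs_strong_converges_everywhere[OF assms(1), of z] by simp
qed

lemma J_ser_deriv: "z \<noteq> 0 \<Longrightarrow> (J_ser has_field_derivative J_ser_eul z / z) (at z)"
  unfolding J_ser_def[abs_def] J_ser_eul_def
  using powser_euler[of J_coeff] summable_coeff by auto

lemma Y_ser_deriv: "z \<noteq> 0 \<Longrightarrow> (Y_ser has_field_derivative Y_ser_eul z / z) (at z)"
  unfolding Y_ser_def[abs_def] Y_ser_eul_def
  using powser_euler[of Y_coeff] summable_coeff by auto

lemma J_ser_eul_deriv: "(J_ser_eul has_field_derivative - J_ser z) (at z)"
proof -
  have "diffs (\<lambda>n. of_nat n * J_coeff n) n = - J_coeff n" for n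
    by (simp add: diffs_def J_coeff_def field_simps power2_eq_square del: of_nat_Suc)
  then have "(\<Sum>n. diffs (\<lambda>n. of_nat n * J_coeff n) n * z ^ n) = - J_ser z"
    using suminf_minus[OF summable_coeff(1)] by (simp add: J_ser_def)
  then show ?thesis
    using termdiffs_strong_converges_everywhere[OF summable_coeff(2), of z]
    unfolding J_ser_eul_def[abs_def] by simp
qed

text \<open>Multiplying the coefficient at \<open>n + 1\<close> by its squared index cancels one
  step of the factorials, and \<open>harm_Suc\<close> splits off \<open>1 / (n + 1)\<close>: that
  part reproduces the derivative of \<open>J_ser\<close>, written
  \<open>J_ser_eul z / z\<close>.\<close>

lemma Y_ser_eul_deriv:
  assumes "z \<noteq> 0"
  shows "(Y_ser_eul has_field_derivative J_ser_eul z / z - Y_ser z) (at z)"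
proof -
  have c: "diffs (\<lambda>n. of_nat n * Y_coeff n) n = diffs J_coeff n - Y_coeff n" for n
    by (simp add: diffs_def J_coeff_def Y_coeff_def harm_Suc field_simps power2_eq_square
        del: of_nat_Suc)
  have "(\<Sum>n. diffs (\<lambda>n. of_nat n * Y_coeff n) n * z ^ n) =
      (\<Sum>n. diffs J_coeff n * z ^ n - Y_coeff n * z ^ n)"
    by (simp only: c left_diff_distrib)
  also have "\<dots> = (\<Sum>n. diffs J_coeff n * z ^ n) - Y_ser z"
    unfolding Y_ser_def
    using termdiff_converges_all[OF summable_coeff(1)] summable_coeff(3)
    by (intro suminf_diff[symmetric]) auto
  also have "(\<Sum>n. diffs J_coeff n * z ^ n) = J_ser_eul z / z"
    using DERIV_unique[OF J_ser_deriv[OF assms]]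
      termdiffs_strong_converges_everywhere[OF summable_coeff(1), of z]
    by (simp add: J_ser_def[abs_def])
  finally show ?thesis
    using termdiffs_strong_converges_everywhere[OF summable_coeff(4), of z]
    unfolding Y_ser_eul_def[abs_def] by simp
qed

text \<open>\<open>hankel1_0 r\<close> as a function of \<open>(r / 2)\<^sup>2\<close>, which is holomorphic on the slit plane.\<close>

definition hankel_sq :: "complex \<Rightarrow> complex" where
  "hankel_sq z = J_ser z
     + \<i> * of_real (2 / pi) * ((Ln z / 2 + euler_mascheroni) * J_ser z - Y_ser z)"

definition hankel_sq_eul :: "complex \<Rightarrow> complex" where
  "hankel_sq_eul z = J_ser_eul z
     + \<i> * of_real (2 / pi) * (J_ser z / 2 + (Ln z / 2 + euler_mascheroni) * J_ser_eul z
         - Y_ser_eul z)"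

text \<open>Together these say that \<open>hankel_sq\<close> solves the Bessel equation off the
  branch cut. In the second equation the logarithm contributes an extra derivative of
  \<open>J_ser\<close>, exactly what the inhomogeneous term of \<open>Y_ser_eul_deriv\<close>
  removes.\<close>

lemma hankel_sq_deriv:
  assumes "z \<notin> \<real>\<^sub>\<le>\<^sub>0"
  shows "(hankel_sq has_field_derivative hankel_sq_eul z / z) (at z)"
    and "(hankel_sq_eul has_field_derivative - hankel_sq z) (at z)"
proof -
  have z: "z \<noteq> 0" using assms by auto
  note d = J_ser_deriv[OF z] Y_ser_deriv[OF z] J_ser_eul_deriv Y_ser_eul_deriv[OF z]
  show "(hankel_sq has_field_derivative hankel_sq_eul z / z) (at z)"
    unfolding hankel_sq_def[abs_def] hankel_sq_eul_def using assms z
    by (auto intro!: derivative_eq_intros d simp: field_simps)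
  show "(hankel_sq_eul has_field_derivative - hankel_sq z) (at z)"
    unfolding hankel_sq_eul_def[abs_def] hankel_sq_def using assms z
    by (auto intro!: derivative_eq_intros d simp: field_simps)
qed

lemma J_ser_bessel: "J_ser (of_real ((r / 2)\<^sup>2)) = of_real (bessel_J0 r)"
proof -
  have eq: "J_coeff n * of_real ((r / 2)\<^sup>2) ^ n
      = of_real ((-1) ^ n * (r / 2) ^ (2 * n) / (fact n)\<^sup>2)" for n
    by (simp add: J_coeff_def power_mult power_divide)
  have "summable (\<lambda>n. (-1) ^ n * (r / 2) ^ (2 * n) / (fact n)\<^sup>2 :: real)"
    using summable_coeff(1)[of "of_real ((r / 2)\<^sup>2)"] unfolding eq by (simp only: summable_complex_of_real)
  then show ?thesis
    unfolding J_ser_def bessel_J0_def eq by (rule suminf_of_real[symmetric])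
qed

lemma Y_ser_bessel:
  "Y_ser (of_real ((r / 2)\<^sup>2)) = of_real (\<Sum>n. (-1) ^ n * harm n * (r / 2) ^ (2 * n) / (fact n)\<^sup>2)"
proof -
  have eq: "Y_coeff n * of_real ((r / 2)\<^sup>2) ^ n
      = of_real ((-1) ^ n * harm n * (r / 2) ^ (2 * n) / (fact n)\<^sup>2)" for n
    by (simp add: Y_coeff_def power_mult power_divide of_real_harm)
  have "summable (\<lambda>n. (-1) ^ n * harm n * (r / 2) ^ (2 * n) / (fact n)\<^sup>2 :: real)"
    using summable_coeff(3)[of "of_real ((r / 2)\<^sup>2)"] unfolding eq by (simp only: summable_complex_of_real)
  then show ?thesis
    unfolding Y_ser_def eq by (rule suminf_of_real[symmetric])
qed

lemma hankel1_0_eq: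
  assumes "r > 0"
  shows "hankel1_0 r = hankel_sq (of_real ((r / 2)\<^sup>2))"
proof -
  have "Ln (of_real ((r / 2)\<^sup>2)) / 2 = of_real (ln (r / 2))"
    using assms by (simp add: Ln_of_real ln_realpow del: of_real_power of_real_divide)
  then show ?thesis
    unfolding hankel1_0_def hankel_sq_def J_ser_bessel Y_ser_bessel bessel_Y0_def by simp
qed

section \<open>Asymptotics of an oscillator with an integrable perturbation\<close>

lemma tendsto_of_derivative_decay:
  fixes f :: "real \<Rightarrow> 'a::banach"
  assumes "r0 > 0"
    and deriv: "\<And>r. r \<ge> r0 \<Longrightarrow> (f has_vector_derivative f' r) (at r)"
    and bound: "\<And>r. r \<ge> r0 \<Longrightarrow> norm (f' r) \<le> C / r\<^sup>2"
  shows "\<exists>L. (f \<longlongrightarrow> L) at_top"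
proof -
  have "0 \<le> C / r0\<^sup>2" using bound[of r0] norm_ge_zero order_trans by blast
  then have "0 \<le> C" using \<open>r0 > 0\<close> by (simp add: zero_le_divide_iff)
  \<comment> \<open>\<open>- C / x\<close> is a primitive of the bound, so beyond \<open>s\<close>
    the function moves by at most the tail \<open>C / s\<close>.\<close>
  have diff: "norm (f r - f s) \<le> C / s" if "r0 \<le> s" "s \<le> r" for r s
  proof (cases "s = r")
    case False
    with that have "s < r" by simp
    have "norm (f r - f s) \<le> - C / r - (- C / s)"
    proof (rule differentiable_bound_general[OF \<open>s < r\<close>])
      show "continuous_on {s..r} f"
        by (intro continuous_at_imp_continuous_on ballI)
          (meson atLeastAtMost_iff deriv has_vector_derivative_continuous order_trans that(1))
      show "continuous_on {s..r} (\<lambda>x. - C / x)"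
        using that \<open>r0 > 0\<close> by (intro continuous_intros) auto
      show "(f has_vector_derivative f' x) (at x)" if "s < x" "x < r" for x
        using deriv that \<open>r0 \<le> s\<close> by auto
      show "((\<lambda>x. - C / x) has_vector_derivative C / x\<^sup>2) (at x)" if "s < x" "x < r" for x
        unfolding has_real_derivative_iff_has_vector_derivative[symmetric]
        using that \<open>r0 \<le> s\<close> \<open>r0 > 0\<close>
        by (auto intro!: derivative_eq_intros simp: power2_eq_square)
      show "norm (f' x) \<le> C / x\<^sup>2" if "s < x" "x < r" for x
        using bound that \<open>r0 \<le> s\<close> by auto
    qed
    then show ?thesis using \<open>0 \<le> C\<close> that \<open>r0 > 0\<close>
      by (smt (verit) divide_minus_left divide_nonneg_pos)
  qed (use \<open>0 \<le> C\<close> that \<open>r0 > 0\<close> in auto)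
  have inv: "(\<lambda>n. C / (r0 + real n)) \<longlonglongrightarrow> 0"
    by real_asymp
  have "Cauchy (\<lambda>n. f (r0 + real n))"
  proof (rule CauchyI')
    fix e :: real assume "0 < e"
    then obtain N where N: "C / (r0 + real N) < e"
      using order_tendstoD(2)[OF inv, of e] by (auto simp: eventually_sequentially)
    show "\<exists>M. \<forall>m\<ge>M. \<forall>n>m. dist (f (r0 + real m)) (f (r0 + real n)) < e"
    proof (intro exI[of _ N] allI impI)
      fix m n assume mn: "N \<le> m" "m < n"
      have "dist (f (r0 + real m)) (f (r0 + real n)) \<le> C / (r0 + real m)"
        using diff[of "r0 + real m" "r0 + real n"] mn by (simp add: dist_norm norm_minus_commute)
      also have "\<dots> \<le> C / (r0 + real N)"
        using mn \<open>0 \<le> C\<close> \<open>r0 > 0\<close> by (intro divide_left_mono) auto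
      finally show "dist (f (r0 + real m)) (f (r0 + real n)) < e" using N by simp
    qed
  qed
  then obtain L where L: "(\<lambda>n. f (r0 + real n)) \<longlonglongrightarrow> L"
    by (auto simp: Cauchy_convergent_iff convergent_def)
  have "norm (f s - L) \<le> C / s" if "s \<ge> r0" for s
  proof (rule LIMSEQ_le_const2)
    show "(\<lambda>n. norm (f s - f (r0 + real n))) \<longlonglongrightarrow> norm (f s - L)"
      by (intro tendsto_intros L)
    show "\<exists>N. \<forall>n\<ge>N. norm (f s - f (r0 + real n)) \<le> C / s"
    proof (intro exI[of _ "nat \<lceil>s\<rceil>"] allI impI)
      fix n assume "nat \<lceil>s\<rceil> \<le> n"
      then have "s \<le> r0 + real n" using \<open>r0 > 0\<close> by linarith
      then show "norm (f s - f (r0 + real n)) \<le> C / s"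
        using diff[of s "r0 + real n"] that by (simp add: norm_minus_commute)
    qed
  qed
  then have "\<forall>\<^sub>F s in at_top. norm (f s - L) \<le> C / s"
    by (auto simp: eventually_at_top_linorder)
  moreover have "((\<lambda>s. C / s) \<longlongrightarrow> 0) at_top" by real_asymp
  ultimately have "((\<lambda>s. f s - L) \<longlongrightarrow> 0) at_top"
    by (rule Lim_null_comparison)
  then show ?thesis using Lim_null by blast
qed

text \<open>Liouville normal form of the Bessel equation of order 0: the substitution
  \<open>V r = sqrt r * hankel1_0 r\<close> removes the first-order term and leaves an oscillator
  whose perturbation \<open>1 / (4 * r^2)\<close> is integrable at infinity.\<close>

locale perturbed_oscillator =
  fixes V U :: "real \<Rightarrow> complex" and r0 :: real
  assumes r0: "r0 > 0"
    and V_deriv: "\<And>r. r \<ge> r0 \<Longrightarrow> (V has_vector_derivative U r) (at r)"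
    and U_deriv: "\<And>r. r \<ge> r0 \<Longrightarrow> (U has_vector_derivative - ((1 + 1 / (4 * r\<^sup>2)) *\<^sub>R V r)) (at r)"
begin

definition energy :: "real \<Rightarrow> real" where
  "energy r = (cmod (V r))\<^sup>2 + (cmod (U r))\<^sup>2"

text \<open>Variation of constants: \<open>V\<close> is written as a combination of
  \<open>cis r\<close> and \<open>cis (- r)\<close>, and \<open>U\<close> as the same combination of
  their derivatives. The two coefficients are \<open>amplitude 1\<close> and
  \<open>amplitude (-1)\<close>; they would be constant without the perturbation.\<close>

definition amplitude :: "real \<Rightarrow> real \<Rightarrow> complex" where
  "amplitude \<sigma> r = cis (- \<sigma> * r) * (V r - \<i> * of_real \<sigma> * U r) / 2"

lemma energy_deriv:
  assumes "r \<ge> r0"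
  shows "(energy has_real_derivative - ((V r \<bullet> U r) / (2 * r\<^sup>2))) (at r)"
proof -
  have e: "energy = (\<lambda>r. V r \<bullet> V r + U r \<bullet> U r)"
    by (auto simp: energy_def dot_square_norm)
  have "(energy has_vector_derivative
      (V r \<bullet> U r + U r \<bullet> V r) + (U r \<bullet> - ((1 + 1 / (4 * r\<^sup>2)) *\<^sub>R V r) + - ((1 + 1 / (4 * r\<^sup>2)) *\<^sub>R V r) \<bullet> U r)) (at r)"
    unfolding e
    by (intro has_vector_derivative_add bounded_bilinear.has_vector_derivative[OF bounded_bilinear_inner]
        V_deriv U_deriv assms)
  then show ?thesis
    unfolding has_real_derivative_iff_has_vector_derivative
    by (rule back_subst[of "\<lambda>x. (energy has_vector_derivative x) (at r)"])
      (simp add: inner_commute algebra_simps)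
qed

lemma inner_le_energy: "2 * \<bar>V r \<bullet> U r\<bar> \<le> energy r"
proof -
  have "(V r - U r) \<bullet> (V r - U r) = energy r - 2 * (V r \<bullet> U r)"
    "(V r + U r) \<bullet> (V r + U r) = energy r + 2 * (V r \<bullet> U r)"
    by (simp_all add: energy_def power2_norm_eq_inner inner_diff_left inner_diff_right
        inner_add_left inner_add_right inner_commute)
  then show ?thesis
    using inner_ge_zero[of "V r - U r"] inner_ge_zero[of "V r + U r"] by linarith
qed

text \<open>The unperturbed energy is conserved; here its derivative is at most
  \<open>energy r / (4 * r^2)\<close> in absolute value, by \<open>energy_deriv\<close> and
  \<open>inner_le_energy\<close>. The integrating factors \<open>exp (- 1 / (4 * r))\<close> and
  \<open>exp (1 / (4 * r))\<close> turn this into a nondecreasing and a nonincreasing quantity; the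
  sign \<sigma> treats both at once.\<close>

lemma energy_bounds:
  assumes "r \<ge> r0"
  shows "energy r0 * exp (- 1 / (4 * r0)) \<le> energy r"
    and "energy r \<le> energy r0 * exp (1 / (4 * r0))"
proof -
  have e0: "0 \<le> energy s" for s by (simp add: energy_def)
  have mono: "\<sigma> * (energy r0 * exp (- \<sigma> / (4 * r0))) \<le> \<sigma> * (energy r * exp (- \<sigma> / (4 * r)))"
    if "\<sigma> = 1 \<or> \<sigma> = -1" for \<sigma> :: real
  proof (rule DERIV_nonneg_imp_nondecreasing[OF assms])
    fix x assume x: "r0 \<le> x" "x \<le> r"
    have "((\<lambda>r. \<sigma> * (energy r * exp (- \<sigma> / (4 * r)))) has_real_derivative
       (energy x - 2 * \<sigma> * (V x \<bullet> U x)) / (4 * x\<^sup>2) * exp (- \<sigma> / (4 * x))) (at x)"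
      using x r0 that
      by (auto intro!: derivative_eq_intros energy_deriv simp: field_simps power2_eq_square)
    moreover have "0 \<le> (energy x - 2 * \<sigma> * (V x \<bullet> U x)) / (4 * x\<^sup>2) * exp (- \<sigma> / (4 * x))"
      using inner_le_energy[of x] that by (intro mult_nonneg_nonneg divide_nonneg_nonneg) auto
    ultimately show "\<exists>y. ((\<lambda>r. \<sigma> * (energy r * exp (- \<sigma> / (4 * r)))) has_real_derivative y) (at x) \<and> 0 \<le> y"
      by blast
  qed
  have "energy r * exp (- 1 / (4 * r)) \<le> energy r"
    using e0[of r] r0 assms by (intro mult_left_le) auto
  then show "energy r0 * exp (- 1 / (4 * r0)) \<le> energy r"
    using mono[of 1] by simp
  have "energy r \<le> energy r * exp (1 / (4 * r))"
    using mult_left_mono[OF _ e0[of r], of 1 "exp (1 / (4 * r))"] r0 assms by simp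
  then show "energy r \<le> energy r0 * exp (1 / (4 * r0))"
    using mono[of "-1"] by simp
qed

lemma amplitude_converges:
  assumes "\<sigma> = 1 \<or> \<sigma> = -1"
  shows "\<exists>a. (amplitude \<sigma> \<longlongrightarrow> a) at_top"
proof (rule tendsto_of_derivative_decay[OF r0])
  fix r assume r: "r \<ge> r0"
  define B where "B = sqrt (energy r0 * exp (1 / (4 * r0)))"
  have "cmod (V r) \<le> sqrt (energy r)"
    by (simp add: energy_def real_le_rsqrt)
  also have "\<dots> \<le> B" unfolding B_def using energy_bounds(2)[OF r] by simp
  finally have VB: "cmod (V r) \<le> B" .
  \<comment> \<open>In the derivative of the amplitude the unperturbed terms cancel; what remains
    carries the factor \<open>1 / (4 * r^2)\<close>, halved by the definition.\<close>
  let ?d = "\<i> * of_real \<sigma> * cis (- \<sigma> * r) * V r / of_real (8 * r\<^sup>2)"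
  have cis: "((\<lambda>r. cis (- \<sigma> * r)) has_vector_derivative (- \<i> * of_real \<sigma> * cis (- \<sigma> * r))) (at r)"
    unfolding cis_conv_exp
    by (auto intro!: derivative_eq_intros has_vector_derivative_real_field simp: field_simps)
  have "(amplitude \<sigma> has_vector_derivative
     (cis (- \<sigma> * r) * (U r - \<i> * of_real \<sigma> * - ((1 + 1 / (4 * r\<^sup>2)) *\<^sub>R V r)) +
       (- \<i> * of_real \<sigma> * cis (- \<sigma> * r)) * (V r - \<i> * of_real \<sigma> * U r)) / 2) (at r)"
    unfolding amplitude_def[abs_def]
    by (intro has_vector_derivative_divide has_vector_derivative_mult has_vector_derivative_diff
        has_vector_derivative_mult_right cis V_deriv U_deriv r)
  also have "(cis (- \<sigma> * r) * (U r - \<i> * of_real \<sigma> * - ((1 + 1 / (4 * r\<^sup>2)) *\<^sub>R V r)) +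
       (- \<i> * of_real \<sigma> * cis (- \<sigma> * r)) * (V r - \<i> * of_real \<sigma> * U r)) / 2 = ?d"
    using assms r r0 by (auto simp: scaleR_conv_of_real field_simps power2_eq_square)
  finally show "(amplitude \<sigma> has_vector_derivative ?d) (at r)" .
  show "norm ?d \<le> (sqrt (energy r0 * exp (1 / (4 * r0))) / 8) / r\<^sup>2"
    using assms VB r r0 unfolding B_def[symmetric]
    by (auto simp: norm_mult norm_divide norm_power field_simps)
qed

lemma asymptotics:
  assumes "V r0 \<noteq> 0"
  obtains a b where "((\<lambda>r. V r - (a * cis r + b * cis (- r))) \<longlongrightarrow> 0) at_top" "a \<noteq> 0 \<or> b \<noteq> 0"
proof -
  obtain a where a: "(amplitude 1 \<longlongrightarrow> a) at_top" using amplitude_converges by blast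
  obtain b where b: "(amplitude (-1) \<longlongrightarrow> b) at_top" using amplitude_converges by blast
  have V: "V r = amplitude 1 r * cis r + amplitude (-1) r * cis (- r)" for r
    by (simp add: amplitude_def field_simps cis_mult)
  have "((\<lambda>r. (amplitude 1 r - a) * cis r + (amplitude (-1) r - b) * cis (- r)) \<longlongrightarrow> 0) at_top"
  proof (rule tendsto_add_zero)
    show "((\<lambda>r. (amplitude 1 r - a) * cis r) \<longlongrightarrow> 0) at_top"
      using Lim_null[THEN iffD1, OF a, THEN tendsto_norm_zero]
      by (intro tendsto_norm_zero_cancel[of "\<lambda>r. (amplitude 1 r - a) * cis r"]) (simp add: norm_mult)
    show "((\<lambda>r. (amplitude (-1) r - b) * cis (- r)) \<longlongrightarrow> 0) at_top"
      using Lim_null[THEN iffD1, OF b, THEN tendsto_norm_zero]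
      by (intro tendsto_norm_zero_cancel[of "\<lambda>r. (amplitude (-1) r - b) * cis (- r)"]) (simp add: norm_mult)
  qed
  then have lim: "((\<lambda>r. V r - (a * cis r + b * cis (- r))) \<longlongrightarrow> 0) at_top"
    by (simp add: V algebra_simps)
  \<comment> \<open>The energy is twice the sum of the squared moduli of the amplitudes, so two
    vanishing limits would contradict the positive lower bound of
    \<open>energy_bounds\<close>.\<close>
  have "a \<noteq> 0 \<or> b \<noteq> 0"
  proof (rule ccontr)
    assume "\<not> ?thesis"
    then have "((\<lambda>r. 2 * ((cmod (amplitude 1 r))\<^sup>2 + (cmod (amplitude (-1) r))\<^sup>2)) \<longlongrightarrow> 2 * ((cmod 0)\<^sup>2 + (cmod 0)\<^sup>2)) at_top"
      using a b by (intro tendsto_intros) auto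
    moreover have "2 * ((cmod (amplitude 1 r))\<^sup>2 + (cmod (amplitude (-1) r))\<^sup>2) = energy r" for r
      unfolding amplitude_def energy_def norm_mult norm_divide
      by (simp add: cmod_power2 power_divide field_simps) (simp add: power2_eq_square algebra_simps)
    ultimately have "(energy \<longlongrightarrow> 0) at_top" by simp
    moreover have "\<forall>\<^sub>F r in at_top. energy r0 * exp (- 1 / (4 * r0)) \<le> energy r"
      using energy_bounds(1) by (auto simp: eventually_at_top_linorder)
    ultimately have "energy r0 * exp (- 1 / (4 * r0)) \<le> 0"
      by (intro tendsto_lowerbound[of energy]) auto
    then show False using assms
      by (simp add: energy_def mult_le_0_iff) (smt (verit) zero_less_norm_iff zero_less_power2 zero_le_power2)
  qed
  then show thesis using lim that by blast
qed

end

lemma hankel1_0_asymptotics: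
  obtains a b where "((\<lambda>r. of_real (sqrt r) * hankel1_0 r - (a * cis r + b * cis (- r))) \<longlongrightarrow> 0) at_top"
    "a \<noteq> 0 \<or> b \<noteq> 0"
proof -
  let ?w = "\<lambda>r::real. complex_of_real ((r / 2)\<^sup>2)"
  define h where "h = (\<lambda>r. hankel_sq (?w r))"
  define N where "N = (\<lambda>r. hankel_sq_eul (?w r))"
  define V where "V = (\<lambda>r. of_real (sqrt r) * h r)"
  \<comment> \<open>The chain rule with \<open>z = (r / 2)^2\<close> gives
    \<open>2 * N r / r\<close> as the derivative of \<open>h\<close>; hence this is the derivative
    of \<open>V\<close>.\<close>
  define U where "U = (\<lambda>r. of_real (1 / sqrt r) * (h r / 2 + 2 * N r))"
  have sqrt: "((\<lambda>r. complex_of_real (sqrt r)) has_vector_derivative of_real (1 / (2 * sqrt r))) (at r)"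
    if "r > 0" for r
    using that by (intro has_vector_derivative_of_real)
      (auto intro!: derivative_eq_intros simp: field_simps)
  have w: "(?w has_vector_derivative of_real (r / 2)) (at r)" for r
    by (rule has_vector_derivative_of_real) (auto intro!: derivative_eq_intros)
  have nonneg: "?w r \<notin> \<real>\<^sub>\<le>\<^sub>0" if "r > 0" for r
    using that by (auto simp: complex_nonpos_Reals_iff simp del: of_real_power of_real_divide)
  have h': "(h has_vector_derivative 2 * N r / of_real r) (at r)" if "r > 0" for r
    using field_vector_diff_chain_at[OF w hankel_sq_deriv(1)[OF nonneg[OF that]]] that
    by (simp add: h_def N_def o_def field_simps power2_eq_square)
  have N': "(N has_vector_derivative - (of_real (r / 2) * h r)) (at r)" if "r > 0" for r
    using field_vector_diff_chain_at[OF w hankel_sq_deriv(2)[OF nonneg[OF that]]] that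
    by (simp add: h_def N_def o_def)
  have ss: "complex_of_real (sqrt r) * complex_of_real (sqrt r) = of_real r" if "r > 0" for r
    using that by (simp flip: of_real_mult)
  have V': "(V has_vector_derivative U r) (at r)" if "r > 0" for r
  proof -
    have "(V has_vector_derivative
       of_real (sqrt r) * (2 * N r / of_real r) + of_real (1 / (2 * sqrt r)) * h r) (at r)"
      unfolding V_def by (intro has_vector_derivative_mult sqrt h' that)
    also have "of_real (sqrt r) * (2 * N r / of_real r) + of_real (1 / (2 * sqrt r)) * h r = U r"
      unfolding U_def ss[OF that, symmetric] using that by (simp add: field_simps)
    finally show ?thesis .
  qed
  have U': "(U has_vector_derivative - ((1 + 1 / (4 * r\<^sup>2)) *\<^sub>R V r)) (at r)" if "r > 0" for r
  proof -
    have isqrt: "((\<lambda>r. complex_of_real (1 / sqrt r)) has_vector_derivative of_real (- 1 / (2 * r * sqrt r))) (at r)"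
      using that by (intro has_vector_derivative_of_real)
        (auto intro!: derivative_eq_intros simp: field_simps)
    have "(U has_vector_derivative
        of_real (1 / sqrt r) * (2 * N r / of_real r / 2 + 2 * - (of_real (r / 2) * h r)) +
        of_real (- 1 / (2 * r * sqrt r)) * (h r / 2 + 2 * N r)) (at r)"
      unfolding U_def
      by (rule has_vector_derivative_mult[OF isqrt has_vector_derivative_add[OF
            has_vector_derivative_divide[OF h'[OF that]]
            has_vector_derivative_mult_right[OF N'[OF that]]]])
    also have "of_real (1 / sqrt r) * (2 * N r / of_real r / 2 + 2 * - (of_real (r / 2) * h r)) +
        of_real (- 1 / (2 * r * sqrt r)) * (h r / 2 + 2 * N r) = - ((1 + 1 / (4 * r\<^sup>2)) *\<^sub>R V r)"
      unfolding V_def scaleR_conv_of_real of_real_add of_real_divide of_real_mult of_real_power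
        ss[OF that, symmetric] power2_eq_square
      using that by (simp add: field_simps)
    finally show ?thesis .
  qed
  \<comment> \<open>A starting point with nonzero value: near 0 the real part
    \<open>bessel_J0\<close> is close to 1, whatever the imaginary part does.\<close>
  have "isCont J_ser 0"
    using isCont_powser_converges_everywhere[OF summable_coeff(1)] unfolding J_ser_def[abs_def] by blast
  moreover have "J_ser 0 = 1" unfolding J_ser_def powser_zero by (simp add: J_coeff_def)
  ultimately have "J_ser \<midarrow>0\<rightarrow> 1" by (simp add: isCont_def)
  moreover have "filterlim ?w (at 0) (at_right 0)"
  proof -
    have "(?w \<longlongrightarrow> of_real ((0/2)\<^sup>2)) (at_right 0)" by (intro tendsto_intros) simp
    moreover have "\<forall>\<^sub>F r in at_right 0. ?w r \<noteq> 0"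
      using eventually_at_right_less[of "0::real"] by eventually_elim simp
    ultimately show ?thesis by (intro filterlim_atI) auto
  qed
  ultimately have "((\<lambda>r. J_ser (?w r)) \<longlongrightarrow> 1) (at_right 0)"
    by (rule filterlim_compose)
  then have "\<forall>\<^sub>F r in at_right 0. J_ser (?w r) \<noteq> 0"
    by (rule tendsto_imp_eventually_ne) simp
  then obtain r0 where r0: "r0 > 0" "J_ser (?w r0) \<noteq> 0"
    using eventually_happens'[OF trivial_limit_at_right_real]
      eventually_conj[OF _ eventually_at_right_less[of "0::real"]] by (metis (mono_tags, lifting))
  have "hankel1_0 r0 \<noteq> 0"
    using r0(2) unfolding hankel1_0_def J_ser_bessel by (simp add: complex_eq_iff)
  then have "V r0 \<noteq> 0" using r0 by (simp add: V_def h_def hankel1_0_eq)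
  interpret perturbed_oscillator V U r0
    using r0 V' U' by unfold_locales auto
  obtain a b where ab: "((\<lambda>r. V r - (a * cis r + b * cis (- r))) \<longlongrightarrow> 0) at_top" "a \<noteq> 0 \<or> b \<noteq> 0"
    using asymptotics[OF \<open>V r0 \<noteq> 0\<close>] by blast
  have "\<forall>\<^sub>F r in at_top. V r - (a * cis r + b * cis (- r)) = of_real (sqrt r) * hankel1_0 r - (a * cis r + b * cis (- r))"
    using eventually_gt_at_top[of 0]
    by eventually_elim (simp add: V_def h_def hankel1_0_eq)
  then show thesis
    using that[OF Lim_transform_eventually[OF ab(1)] ab(2)] by blast
qed

section \<open>Integrals depending on a parameter\<close>

lemma integrable_bounded_mult:
  fixes K h :: "'a \<Rightarrow> complex"
  assumes "integrable M h" "K \<in> borel_measurable M" "\<And>y. y \<in> space M \<Longrightarrow> cmod (K y) \<le> B"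
  shows "integrable M (\<lambda>y. K y * h y)"
proof (rule Bochner_Integration.integrable_bound)
  show "integrable M (\<lambda>y. of_real B * h y)" using assms(1) by simp
  show "AE y in M. cmod (K y * h y) \<le> cmod (of_real B * h y)"
    using assms(3) by (intro AE_I2) (auto simp: norm_mult intro!: mult_right_mono order.trans[OF assms(3)])
qed (use assms in measurable)

lemma continuous_on_integral_kernel:
  fixes K :: "'b::metric_space \<Rightarrow> 'a \<Rightarrow> complex"
  assumes h: "integrable M h"
    and meas: "\<And>x. x \<in> S \<Longrightarrow> K x \<in> borel_measurable M"
    and cont: "\<And>y. y \<in> space M \<Longrightarrow> continuous_on S (\<lambda>x. K x y)"
    and bound: "\<And>x y. x \<in> S \<Longrightarrow> y \<in> space M \<Longrightarrow> cmod (K x y) \<le> B"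
  shows "continuous_on S (\<lambda>x. LINT y|M. K x y * h y)"
proof (rule continuous_on_sequentiallyI)
  fix u a assume u: "\<forall>n. u n \<in> S" "a \<in> S" "u \<longlonglongrightarrow> a"
  show "(\<lambda>n. LINT y|M. K (u n) y * h y) \<longlonglongrightarrow> (LINT y|M. K a y * h y)"
  proof (rule integral_dominated_convergence[where w = "\<lambda>y. B * cmod (h y)"])
    show "(\<lambda>y. K a y * h y) \<in> borel_measurable M" "(\<lambda>y. K (u n) y * h y) \<in> borel_measurable M" for n
      using meas u h by (auto intro!: borel_measurable_times)
    show "integrable M (\<lambda>y. B * cmod (h y))" using h by simp
    show "AE y in M. (\<lambda>n. K (u n) y * h y) \<longlonglongrightarrow> K a y * h y"
    proof (rule AE_I2)
      fix y assume "y \<in> space M"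
      then have "(\<lambda>n. K (u n) y) \<longlonglongrightarrow> K a y"
        using continuous_on_tendsto_compose[OF cont u(3) u(2)] u(1) by auto
      then show "(\<lambda>n. K (u n) y * h y) \<longlonglongrightarrow> K a y * h y" by (rule tendsto_mult_right)
    qed
    show "AE y in M. cmod (K (u n) y * h y) \<le> B * cmod (h y)" for n
      using bound u(1) by (intro AE_I2) (auto simp: norm_mult intro!: mult_right_mono)
  qed
qed

text \<open>Cauchy's estimate turns the uniform bound on \<open>K\<close> into one on its derivative
  in \<open>t\<close>, hence on the difference quotients; dominated convergence along sequences then
  differentiates under the integral.\<close>

lemma holomorphic_on_integral_kernel:
  fixes K :: "complex \<Rightarrow> 'a \<Rightarrow> complex"
  assumes "open S" and h: "integrable M h"
    and meas: "\<And>t. t \<in> S \<Longrightarrow> K t \<in> borel_measurable M"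
    and holo: "\<And>y. y \<in> space M \<Longrightarrow> (\<lambda>t. K t y) holomorphic_on S"
    and bound: "\<And>t y. t \<in> S \<Longrightarrow> y \<in> space M \<Longrightarrow> cmod (K t y) \<le> B"
  shows "(\<lambda>t. LINT y|M. K t y * h y) holomorphic_on S"
  unfolding holomorphic_on_open[OF \<open>open S\<close>]
proof
  fix t0 assume "t0 \<in> S"
  obtain e where e: "e > 0" "cball t0 e \<subseteq> S"
    using \<open>open S\<close> \<open>t0 \<in> S\<close> open_contains_cball by blast
  \<comment> \<open>Half the radius: closed discs of radius \<rho> about points of
    \<open>ball t0 \<rho>\<close> still lie in \<open>cball t0 e\<close>.\<close>
  define \<rho> where "\<rho> = e / 2"
  have \<rho>: "\<rho> > 0" using e by (simp add: \<rho>_def)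
  have sub: "cball t \<rho> \<subseteq> S" if "t \<in> ball t0 \<rho>" for t
  proof
    fix z assume "z \<in> cball t \<rho>"
    then have "dist t0 z \<le> e" using that dist_triangle[of t0 z t] by (simp add: \<rho>_def)
    then show "z \<in> S" using e by auto
  qed
  have der: "((\<lambda>t. K t y) has_field_derivative deriv (\<lambda>t. K t y) t) (at t)" if "y \<in> space M" "t \<in> S" for y t
    using holomorphic_derivI[OF holo \<open>open S\<close>] that by blast
  have derB: "cmod (deriv (\<lambda>t. K t y) t) \<le> B / \<rho>" if "y \<in> space M" "t \<in> ball t0 \<rho>" for y t
  proof -
    have "cmod ((deriv ^^ 1) (\<lambda>t. K t y) t) \<le> fact 1 * B / \<rho> ^ 1"
    proof (rule Cauchy_inequality)
      show "(\<lambda>t. K t y) holomorphic_on ball t \<rho>"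
        using holo[OF that(1)] sub[OF that(2)] ball_subset_cball
        by (blast intro: holomorphic_on_subset)
      show "continuous_on (cball t \<rho>) (\<lambda>t. K t y)"
        using holomorphic_on_imp_continuous_on[OF holo[OF that(1)]] sub[OF that(2)] by (rule continuous_on_subset)
      show "cmod (K x y) \<le> B" if "cmod (t - x) = \<rho>" for x
        using sub[OF \<open>t \<in> ball t0 \<rho>\<close>] that \<open>y \<in> space M\<close> by (intro bound) (auto simp: dist_norm)
    qed (use \<rho> in auto)
    then show ?thesis by simp
  qed
  have lip: "cmod (K t y - K t0 y) \<le> B / \<rho> * cmod (t - t0)" if "y \<in> space M" "t \<in> ball t0 \<rho>" for y t
  proof (rule field_differentiable_bound[of "ball t0 \<rho>"])
    show "((\<lambda>t. K t y) has_field_derivative deriv (\<lambda>t. K t y) z) (at z within ball t0 \<rho>)" if "z \<in> ball t0 \<rho>" for z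
    proof (rule has_field_derivative_at_within[OF der[OF \<open>y \<in> space M\<close>]])
      show "z \<in> S" using sub[OF that] \<rho> by (auto simp: subset_iff)
    qed
  qed (use derB that \<rho> in auto)
  have "((\<lambda>t. ((LINT y|M. K t y * h y) - (LINT y|M. K t0 y * h y)) / (t - t0))
      \<longlongrightarrow> (LINT y|M. deriv (\<lambda>t. K t y) t0 * h y)) (at t0 within ball t0 \<rho>)"
    unfolding tendsto_at_iff_sequentially
  proof (intro allI impI)
    fix X assume X: "\<forall>i. X i \<in> ball t0 \<rho> - {t0}" "X \<longlonglongrightarrow> t0"
    have XS: "X n \<in> S" for n using X sub[of "X n"] \<rho> by auto
    have int: "integrable M (\<lambda>y. K t y * h y)" if "t \<in> S" for t
      using integrable_bounded_mult[OF h meas bound] that by blast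
    have lim: "(\<lambda>n. (K (X n) y - K t0 y) / (X n - t0)) \<longlonglongrightarrow> deriv (\<lambda>t. K t y) t0" if "y \<in> space M" for y
      using der[OF that \<open>t0 \<in> S\<close>] X unfolding has_field_derivative_iff tendsto_at_iff_sequentially
      by (auto simp: o_def)
    have "(\<lambda>n. LINT y|M. (K (X n) y - K t0 y) / (X n - t0) * h y) \<longlonglongrightarrow> (LINT y|M. deriv (\<lambda>t. K t y) t0 * h y)"
    proof (rule integral_dominated_convergence[where w = "\<lambda>y. B / \<rho> * cmod (h y)"])
      show m: "(\<lambda>y. (K (X n) y - K t0 y) / (X n - t0) * h y) \<in> borel_measurable M" for n
        using meas[OF XS[of n]] meas[OF \<open>t0 \<in> S\<close>] h by measurable
      show "(\<lambda>y. deriv (\<lambda>t. K t y) t0 * h y) \<in> borel_measurable M"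
        by (rule borel_measurable_LIMSEQ_metric[
              where f = "\<lambda>n y. (K (X n) y - K t0 y) / (X n - t0) * h y", OF m])
          (intro tendsto_mult_right lim)
      show "integrable M (\<lambda>y. B / \<rho> * cmod (h y))" using h by simp
      show "AE y in M. (\<lambda>n. (K (X n) y - K t0 y) / (X n - t0) * h y) \<longlonglongrightarrow> deriv (\<lambda>t. K t y) t0 * h y"
        by (intro AE_I2 tendsto_mult_right lim)
      show "AE y in M. cmod ((K (X n) y - K t0 y) / (X n - t0) * h y) \<le> B / \<rho> * cmod (h y)" for n
      proof (rule AE_I2)
        fix y assume y: "y \<in> space M"
        have "cmod ((K (X n) y - K t0 y) / (X n - t0)) \<le> B / \<rho>"
          using lip[OF y, of "X n"] X(1) by (auto simp: norm_divide divide_le_eq)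
        then show "cmod ((K (X n) y - K t0 y) / (X n - t0) * h y) \<le> B / \<rho> * cmod (h y)"
          unfolding norm_mult by (rule mult_right_mono) simp
      qed
    qed
    also have "(\<lambda>n. LINT y|M. (K (X n) y - K t0 y) / (X n - t0) * h y)
       = (\<lambda>n. ((LINT y|M. K (X n) y * h y) - (LINT y|M. K t0 y * h y)) / (X n - t0))"
      using int[OF XS] int[OF \<open>t0 \<in> S\<close>]
      by (simp add: left_diff_distrib diff_divide_distrib Bochner_Integration.integral_diff)
    finally show "((\<lambda>t. ((LINT y|M. K t y * h y) - (LINT y|M. K t0 y * h y)) / (t - t0)) \<circ> X)
       \<longlonglongrightarrow> (LINT y|M. deriv (\<lambda>t. K t y) t0 * h y)"
      by (simp add: o_def)
  qed
  then show "\<exists>f'. ((\<lambda>t. LINT y|M. K t y * h y) has_field_derivative f') (at t0)"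
    unfolding has_field_derivative_iff
    using at_within_open[of t0 "ball t0 \<rho>"] \<rho> by (intro exI) simp
qed

section \<open>Potentials: unique continuation and far field\<close>

text \<open>The polarization of the square of \<open>mach_norm\<close>, that is, the bilinear form
  with matrix \<open>m m^T + beta^2 I\<close>. The phases of the far-field plane waves are expressed
  through it.\<close>

definition mach_inner :: "real ^ 'n \<Rightarrow> real ^ 'n \<Rightarrow> real ^ 'n \<Rightarrow> real" where
  "mach_inner m x y = (x \<bullet> m) * (y \<bullet> m) + (mach_beta m)\<^sup>2 * (x \<bullet> y)"

lemma mach_inner_simps:
  "mach_inner m (x + y) z = mach_inner m x z + mach_inner m y z"
  "mach_inner m z (x + y) = mach_inner m z x + mach_inner m z y"
  "mach_inner m (x - y) z = mach_inner m x z - mach_inner m y z"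
  "mach_inner m z (x - y) = mach_inner m z x - mach_inner m z y"
  "mach_inner m (c *\<^sub>R x) z = c * mach_inner m x z"
  "mach_inner m z (c *\<^sub>R x) = c * mach_inner m z x"
  by (simp_all add: mach_inner_def inner_simps algebra_simps)

lemma mach_inner_commute: "mach_inner m x y = mach_inner m y x"
  by (simp add: mach_inner_def inner_commute mult.commute)

lemma mach_norm_sq: "(mach_norm m x)\<^sup>2 = mach_inner m x x"
  unfolding mach_norm_def mach_inner_def power2_norm_eq_inner by (simp add: power2_eq_square)

lemma mach_norm_sq_line:
  "(mach_norm m (z + t *\<^sub>R v - y))\<^sup>2
     = mach_inner m (z - y) (z - y) + 2 * t * mach_inner m (z - y) v + t\<^sup>2 * mach_inner m v v"
proof -
  have "z + t *\<^sub>R v - y = (z - y) + t *\<^sub>R v" by simp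
  moreover have "mach_inner m (u + t *\<^sub>R v) (u + t *\<^sub>R v)
      = mach_inner m u u + 2 * t * mach_inner m u v + t\<^sup>2 * mach_inner m v v" for u
    by (simp only: mach_inner_simps mach_inner_commute[of m v u]) (simp add: power2_eq_square algebra_simps)
  ultimately show ?thesis unfolding mach_norm_sq by metis
qed

lemma mach_norm_nonneg: "0 \<le> mach_norm m x"
  by (simp add: mach_norm_def)

lemma mach_beta_sq: "norm m < 1 \<Longrightarrow> (mach_beta m)\<^sup>2 = 1 - (norm m)\<^sup>2"
  by (simp add: mach_beta_def power_le_one)

lemma mach_beta_pos: "norm m < 1 \<Longrightarrow> 0 < mach_beta m"
  by (simp add: mach_beta_def power_less_one_iff abs_square_less_1)

lemma mach_norm_ge: "norm m < 1 \<Longrightarrow> mach_beta m * norm x \<le> mach_norm m x"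
  unfolding mach_norm_def by (rule real_le_rsqrt) (simp add: power_mult_distrib)

lemma mach_norm_le: 
  assumes "norm m < 1"
  shows "mach_norm m x \<le> norm x"
proof -
  have "(x \<bullet> m)\<^sup>2 \<le> (norm x * norm m)\<^sup>2"
    by (metis Cauchy_Schwarz_ineq2 abs_le_square_iff abs_mult abs_norm_cancel)
  then show ?thesis
    unfolding mach_norm_def mach_beta_sq[OF assms]
    by (intro real_le_lsqrt) (auto simp: algebra_simps)
qed

lemma mach_norm_pos: "norm m < 1 \<Longrightarrow> x \<noteq> 0 \<Longrightarrow> 0 < mach_norm m x"
  using mach_norm_ge[of m x] mach_beta_pos[of m] by (smt (verit) mult_pos_pos zero_less_norm_iff)

lemma mach_norm_scale: "mach_norm m (c *\<^sub>R x) = \<bar>c\<bar> * mach_norm m x"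
proof (rule power2_eq_imp_eq)
  show "(mach_norm m (c *\<^sub>R x))\<^sup>2 = (\<bar>c\<bar> * mach_norm m x)\<^sup>2"
    unfolding power_mult_distrib mach_norm_sq mach_inner_simps by (simp add: power2_eq_square)
qed (simp_all add: mach_norm_nonneg)

lemma measurable_lebesgue_on_continuous:
  fixes f :: "'a::euclidean_space \<Rightarrow> 'b::euclidean_space"
  assumes "open S" "continuous_on S f"
  shows "f \<in> borel_measurable (lebesgue_on S)"
  using assms by (intro continuous_imp_measurable_on_sets_lebesgue) auto

text \<open>Common frame of both dimensions, with \<kappa> standing for
  \<open>k / (mach_beta m)^2\<close>. \<open>G\<close> takes the squared distance, which keeps a
  positive real part when a line parameter is made slightly complex; hence the right
  half-plane.\<close>

locale radial_kernel =
  fixes m :: "real ^ 'n" and \<kappa> :: real and G :: "complex \<Rightarrow> complex" and \<Omega> :: "(real ^ 'n) set"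
  assumes m: "norm m < 1" and \<kappa>: "\<kappa> > 0" and G: "G holomorphic_on {z. 0 < Re z}"
    and \<Omega>: "open \<Omega>" "bounded \<Omega>"
begin

definition kernel :: "real ^ 'n \<Rightarrow> real ^ 'n \<Rightarrow> complex" where
  "kernel x y = cis (- \<kappa> * ((x - y) \<bullet> m)) * G (of_real ((mach_norm m (x - y))\<^sup>2))"

definition potential :: "(real ^ 'n \<Rightarrow> complex) \<Rightarrow> real ^ 'n \<Rightarrow> complex" where
  "potential h x = (LINT y|lebesgue_on \<Omega>. kernel x y * h y)"

lemma space_\<Omega> [simp]: "space (lebesgue_on \<Omega>) = \<Omega>"
  by (simp add: space_restrict_space)

lemma continuous_on_kernel:
  assumes "S \<inter> T = {}"
  shows "continuous_on (S \<times> T) (\<lambda>(x, y). kernel x y)"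
  unfolding kernel_def case_prod_unfold
proof (intro continuous_on_mult)
  show "continuous_on (S \<times> T) (\<lambda>p. cis (- \<kappa> * ((fst p - snd p) \<bullet> m)))"
    by (intro continuous_intros)
  show "continuous_on (S \<times> T) (\<lambda>p. G (of_real ((mach_norm m (fst p - snd p))\<^sup>2)))"
  proof (rule continuous_on_compose2[OF holomorphic_on_imp_continuous_on[OF G]])
    show "continuous_on (S \<times> T) (\<lambda>p. complex_of_real ((mach_norm m (fst p - snd p))\<^sup>2))"
      unfolding mach_norm_def by (intro continuous_intros)
    have "mach_norm m (x - y) \<noteq> 0" if "x \<in> S" "y \<in> T" for x y
    proof -
      have "x - y \<noteq> 0" using assms that by auto
      from mach_norm_pos[OF m this] show ?thesis by simp
    qed
    then show "(\<lambda>p. complex_of_real ((mach_norm m (fst p - snd p))\<^sup>2)) ` (S \<times> T) \<subseteq> {z. 0 < Re z}"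
      by (auto simp flip: of_real_power)
  qed
qed

lemma continuous_on_kernel_left: "y \<notin> S \<Longrightarrow> continuous_on S (\<lambda>x. kernel x y)"
  using continuous_on_compose2[OF continuous_on_kernel[of S "{y}"], of S "\<lambda>x. (x, y)"]
  by (auto simp: continuous_on_Pair continuous_on_id)

lemma continuous_on_kernel_right: "x \<notin> S \<Longrightarrow> continuous_on S (kernel x)"
  using continuous_on_compose2[OF continuous_on_kernel[of "{x}" S], of S "\<lambda>y. (x, y)"]
  by (auto simp: continuous_on_Pair continuous_on_id)

lemma kernel_measurable: "x \<notin> \<Omega> \<Longrightarrow> kernel x \<in> borel_measurable (lebesgue_on \<Omega>)"
  using continuous_on_kernel_right \<Omega>(1) by (intro measurable_lebesgue_on_continuous)

lemma kernel_bounded: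
  assumes "compact S" "S \<inter> closure \<Omega> = {}"
  obtains B where "\<And>x y. x \<in> S \<Longrightarrow> y \<in> \<Omega> \<Longrightarrow> cmod (kernel x y) \<le> B"
proof -
  have "compact ((\<lambda>(x, y). kernel x y) ` (S \<times> closure \<Omega>))"
    using assms \<Omega> by (intro compact_continuous_image continuous_on_kernel compact_Times) auto
  then obtain B where "\<forall>z \<in> (\<lambda>(x, y). kernel x y) ` (S \<times> closure \<Omega>). cmod z \<le> B"
    using compact_imp_bounded bounded_iff by metis
  then show thesis using closure_subset by (intro that[of B]) force
qed

lemma continuous_on_potential:
  assumes "compact S" "S \<inter> closure \<Omega> = {}" "integrable (lebesgue_on \<Omega>) h"
  shows "continuous_on S (potential h)"
proof -
  obtain B where "\<And>x y. x \<in> S \<Longrightarrow> y \<in> \<Omega> \<Longrightarrow> cmod (kernel x y) \<le> B"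
    using kernel_bounded[OF assms(1,2)] by blast
  moreover have "S \<inter> \<Omega> = {}" using assms(2) closure_subset by blast
  ultimately show ?thesis
    unfolding potential_def[abs_def] using assms(3)
    by (intro continuous_on_integral_kernel continuous_on_kernel_left kernel_measurable) auto
qed

text \<open>On a short segment off \<open>closure \<Omega>\<close> the potential is the restriction of a function that is
  holomorphic in a complex neighbourhood of the parameter interval.\<close>

lemma potential_zero_ball:
  assumes h: "integrable (lebesgue_on \<Omega>) h" and r: "ball p (3 * r) \<inter> \<Omega> = {}"
    and zw: "z \<in> ball p r" "w \<in> ball p r"
    and e: "e > 0" "\<And>x. x \<in> ball z e \<Longrightarrow> potential h x = 0"
  shows "potential h w = 0"
proof -
  define v where "v = w - z"
  define W where "W = (\<lambda>(\<tau>::complex) y. of_real (mach_inner m (z - y) (z - y))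
    + 2 * \<tau> * of_real (mach_inner m (z - y) v) + \<tau>\<^sup>2 * of_real (mach_inner m v v))"
  define CK where "CK = (\<lambda>(\<tau>::complex) y. exp (- \<i> * of_real \<kappa> * (of_real ((z - y) \<bullet> m) + \<tau> * of_real (v \<bullet> m)))
    * G (W \<tau> y))"
  \<comment> \<open>A rectangle around the parameters 0 (the point \<open>z\<close>) and 1 (the
    point \<open>w\<close>). For real parts in [-1/2, 3/2] the line stays within
    \<open>2 * r\<close> of \<open>p\<close>, so at distance at least \<open>r\<close> from
    \<Omega>; with the height \<open>mach_beta m / 4\<close> the imaginary part costs at most a
    quarter of \<open>(mach_beta m * r)^2\<close> in \<open>Re (W \<tau> y)\<close>.\<close>
  define lo where "lo = Complex (-1/2) (- mach_beta m / 4)"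
  define hi where "hi = Complex (3/2) (mach_beta m / 4)"
  define F where "F = (\<lambda>\<tau>. LINT y|lebesgue_on \<Omega>. CK \<tau> y * h y)"
  have "r > 0" using zw(1) by (simp add: dist_norm) (smt (verit) norm_ge_zero)
  note \<beta> = mach_beta_pos[OF m]
  have closr: "ball p (3 * r) \<inter> closure \<Omega> = {}"
    using r by (simp add: open_Int_closure_eq_empty)
  have normv: "norm v \<le> 2 * r"
    using zw dist_triangle[of z w p] by (simp add: v_def dist_norm dist_commute norm_minus_commute)
  have ReW: "0 < Re (W \<tau> y)" if "\<tau> \<in> cbox lo hi" "y \<in> closure \<Omega>" for \<tau> y
  proof -
    define t s where "t = Re \<tau>" and "s = Im \<tau>"
    have ts: "-1/2 \<le> t" "t \<le> 3/2" "\<bar>s\<bar> \<le> mach_beta m / 4"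
      using that(1) by (auto simp: in_cbox_complex_iff lo_def hi_def t_def s_def)
    have "norm ((1 - t) *\<^sub>R (z - p) + t *\<^sub>R (w - p)) \<le> \<bar>1 - t\<bar> * norm (z - p) + \<bar>t\<bar> * norm (w - p)"
      by (rule norm_triangle_le) simp
    also have "\<dots> \<le> \<bar>1 - t\<bar> * r + \<bar>t\<bar> * r"
      using zw by (intro add_mono mult_left_mono) (auto simp: dist_norm norm_minus_commute)
    also have "\<dots> = (\<bar>1 - t\<bar> + \<bar>t\<bar>) * r" by (simp add: algebra_simps)
    also have "\<dots> \<le> 2 * r" using ts \<open>r > 0\<close> by (intro mult_right_mono) auto
    also have "(1 - t) *\<^sub>R (z - p) + t *\<^sub>R (w - p) = z + t *\<^sub>R v - p"
      by (simp add: v_def algebra_simps)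
    finally have "norm (z + t *\<^sub>R v - p) \<le> 2 * r" .
    moreover have "3 * r \<le> norm (p - y)" using closr that(2) by (force simp: dist_norm)
    moreover have "norm (p - y) \<le> norm (z + t *\<^sub>R v - p) + norm (z + t *\<^sub>R v - y)"
      by (metis norm_minus_commute norm_triangle_sub add.commute diff_add_cancel norm_triangle_ineq4 diff_diff_eq2)
    ultimately have "r \<le> norm (z + t *\<^sub>R v - y)" by linarith
    then have "mach_beta m * r \<le> mach_beta m * norm (z + t *\<^sub>R v - y)" using \<beta> by simp
    also have "\<dots> \<le> mach_norm m (z + t *\<^sub>R v - y)" by (rule mach_norm_ge[OF m])
    finally have "(mach_beta m * r)\<^sup>2 \<le> (mach_norm m (z + t *\<^sub>R v - y))\<^sup>2"
      using \<beta> \<open>r > 0\<close> by (intro power_mono) auto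
    moreover have "Re (W \<tau> y) = (mach_norm m (z + t *\<^sub>R v - y))\<^sup>2 - s\<^sup>2 * (mach_norm m v)\<^sup>2"
      unfolding W_def mach_norm_sq_line mach_norm_sq[of m v]
      by (simp add: t_def s_def power2_eq_square left_diff_distrib)
    moreover have "s\<^sup>2 * (mach_norm m v)\<^sup>2 \<le> (mach_beta m / 4)\<^sup>2 * (2 * r)\<^sup>2"
    proof (rule mult_mono)
      show "s\<^sup>2 \<le> (mach_beta m / 4)\<^sup>2" using ts(3) by (metis abs_ge_zero power2_abs power_mono)
      show "(mach_norm m v)\<^sup>2 \<le> (2 * r)\<^sup>2"
        using mach_norm_le[OF m, of v] normv mach_norm_nonneg by (intro power_mono) auto
    qed auto
    moreover have "(mach_beta m / 4)\<^sup>2 * (2 * r)\<^sup>2 < (mach_beta m * r)\<^sup>2"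
      using \<beta> \<open>r > 0\<close> by (simp add: power_mult_distrib power_divide)
    ultimately show ?thesis by linarith
  qed
  have contW: "continuous_on X (\<lambda>p. W (fst p) (snd p))" for X
    unfolding W_def mach_inner_def by (intro continuous_intros)
  have contCK: "continuous_on (cbox lo hi \<times> closure \<Omega>) (\<lambda>p. CK (fst p) (snd p))"
    unfolding CK_def
    by (intro continuous_intros continuous_on_compose2[OF holomorphic_on_imp_continuous_on[OF G] contW])
      (use ReW in auto)
  have "compact ((\<lambda>p. CK (fst p) (snd p)) ` (cbox lo hi \<times> closure \<Omega>))"
    using \<Omega> by (intro compact_continuous_image contCK compact_Times) auto
  then obtain B where "\<forall>z \<in> (\<lambda>p. CK (fst p) (snd p)) ` (cbox lo hi \<times> closure \<Omega>). cmod z \<le> B"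
    using compact_imp_bounded bounded_iff by metis
  then have B: "cmod (CK \<tau> y) \<le> B" if "\<tau> \<in> cbox lo hi" "y \<in> \<Omega>" for \<tau> y
    using that closure_subset[of \<Omega>] by force
  have "F holomorphic_on box lo hi"
    unfolding F_def
  proof (rule holomorphic_on_integral_kernel[OF open_box h])
    fix \<tau> assume \<tau>: "\<tau> \<in> box lo hi"
    have "continuous_on \<Omega> (CK \<tau>)"
      using continuous_on_compose2[OF contCK, of \<Omega> "\<lambda>y. (\<tau>, y)"] \<tau> closure_subset[of \<Omega>] box_subset_cbox[of lo hi]
      by (auto simp: continuous_on_Pair continuous_on_id)
    then show "CK \<tau> \<in> borel_measurable (lebesgue_on \<Omega>)"
      using \<Omega>(1) by (intro measurable_lebesgue_on_continuous)
    show "cmod (CK \<tau> y) \<le> B" if "y \<in> space (lebesgue_on \<Omega>)" for y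
      using B \<tau> that box_subset_cbox[of lo hi] by auto
  next
    fix y assume "y \<in> space (lebesgue_on \<Omega>)"
    then have y: "y \<in> closure \<Omega>" using closure_subset[of \<Omega>] by auto
    have "(\<lambda>\<tau>. W \<tau> y) holomorphic_on box lo hi"
      unfolding W_def by (intro holomorphic_intros)
    then have "(G \<circ> (\<lambda>\<tau>. W \<tau> y)) holomorphic_on box lo hi"
      by (rule holomorphic_on_compose_gen[OF _ G]) (use ReW y box_subset_cbox[of lo hi] in auto)
    then have "(\<lambda>\<tau>. G (W \<tau> y)) holomorphic_on box lo hi" by (simp add: o_def)
    then show "(\<lambda>\<tau>. CK \<tau> y) holomorphic_on box lo hi"
      unfolding CK_def by (intro holomorphic_intros)
  qed
  have CK_real: "CK (of_real t) y = kernel (z + t *\<^sub>R v) y" for t y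
  proof -
    have "W (of_real t) y = of_real ((mach_norm m (z + t *\<^sub>R v - y))\<^sup>2)"
      unfolding W_def mach_norm_sq_line by simp
    moreover have "exp (- \<i> * of_real \<kappa> * (of_real ((z - y) \<bullet> m) + of_real t * of_real (v \<bullet> m)))
        = cis (- \<kappa> * ((z + t *\<^sub>R v - y) \<bullet> m))"
      by (simp add: cis_conv_exp inner_simps algebra_simps)
    ultimately show ?thesis by (simp add: CK_def kernel_def)
  qed
  have F_real: "F (of_real t) = potential h (z + t *\<^sub>R v)" for t
    by (simp add: F_def potential_def CK_real)
  \<comment> \<open>The bound 1 keeps the parameters inside the rectangle; the \<open>+ 1\<close>
    covers \<open>v = 0\<close>.\<close>
  define \<delta> where "\<delta> = min 1 (e / (norm v + 1))"
  have \<delta>: "\<delta> > 0" using e by (auto simp: \<delta>_def intro!: divide_pos_pos add_nonneg_pos)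
  have F0: "F (of_real t) = 0" if "0 < t" "t < \<delta>" for t
  proof -
    have "norm (t *\<^sub>R v) \<le> t * (norm v + 1)" using that by simp
    also have "\<dots> < \<delta> * (norm v + 1)" using that by (intro mult_strict_right_mono) (auto intro: add_nonneg_pos)
    also have "\<dots> \<le> e / (norm v + 1) * (norm v + 1)" by (intro mult_right_mono) (auto simp: \<delta>_def)
    also have "\<dots> = e" by (smt (verit) nonzero_eq_divide_eq norm_ge_zero)
    finally show ?thesis unfolding F_real by (intro e(2)) (simp add: dist_norm)
  qed
  have "F 1 = 0"
  proof (rule analytic_continuation[OF \<open>F holomorphic_on box lo hi\<close> open_box])
    show "connected (box lo hi)" by (simp add: convex_connected convex_box)
    show "complex_of_real ` {0<..<\<delta>} \<subseteq> box lo hi"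
      using \<beta> by (auto simp: in_box_complex_iff lo_def hi_def \<delta>_def)
    show "(0::complex) \<in> box lo hi" "1 \<in> box lo hi"
      using \<beta> by (auto simp: in_box_complex_iff lo_def hi_def)
    show "0 islimpt complex_of_real ` {0<..<\<delta>}"
      unfolding islimpt_approachable
    proof (intro allI impI)
      fix d :: real assume "d > 0"
      then show "\<exists>x'\<in>complex_of_real ` {0<..<\<delta>}. x' \<noteq> 0 \<and> dist x' 0 < d"
        using \<delta> by (intro bexI[of _ "of_real (min (\<delta>/2) (d/2))"]) (auto simp: dist_norm)
    qed
    show "F \<tau> = 0" if "\<tau> \<in> complex_of_real ` {0<..<\<delta>}" for \<tau> using F0 that by auto
  qed
  then show ?thesis using F_real[of 1] by (simp add: v_def)
qed

text \<open>Vanishing near a point (\<open>Z\<close>) is locally constant: if it holds at one point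
  of a small ball, \<open>potential_zero_ball\<close> carries the zeros along segments to the whole
  ball. Connectedness propagates it.\<close>

lemma potential_unique_continuation:
  assumes conn: "connected (- closure \<Omega>)" and h: "integrable (lebesgue_on \<Omega>) h"
    and x0: "x0 \<in> - closure \<Omega>" "e > 0" "\<And>x. x \<in> ball x0 e \<Longrightarrow> potential h x = 0"
    and x: "x \<in> - closure \<Omega>"
  shows "potential h x = 0"
proof -
  define Z where "Z = (\<lambda>x. \<exists>e>0. \<forall>y\<in>ball x e. potential h y = 0)"
  have "Z x0 \<longleftrightarrow> Z x"
  proof (rule connected_equivalence_relation[OF conn x0(1) x, of "\<lambda>x y. Z x \<longleftrightarrow> Z y"])
    fix a assume "a \<in> - closure \<Omega>"
    then obtain s where s: "s > 0" "ball a s \<subseteq> - closure \<Omega>"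
      by (meson closed_closure open_Compl open_contains_ball)
    define r where "r = s / 3"
    have "ball a r \<subseteq> ball a s" using s(1) by (intro subset_ball) (simp add: r_def)
    then have r: "r > 0" "ball a (3 * r) \<inter> \<Omega> = {}" "ball a r \<subseteq> - closure \<Omega>"
      using s closure_subset[of \<Omega>] by (auto simp: r_def)
    have spread: "Z b" if "Z c" and b: "b \<in> ball a r" and c: "c \<in> ball a r" for b c
    proof -
      obtain e where e: "e > 0" "\<And>x. x \<in> ball c e \<Longrightarrow> potential h x = 0"
        using \<open>Z c\<close> unfolding Z_def by blast
      obtain d where d: "d > 0" "ball b d \<subseteq> ball a r"
        using b by (meson open_ball open_contains_ball)
      then show ?thesis
        using potential_zero_ball[OF h r(2) c _ e] unfolding Z_def by blast
    qed
    show "\<exists>T. openin (top_of_set (- closure \<Omega>)) T \<and> a \<in> T \<and> (\<forall>x\<in>T. Z a \<longleftrightarrow> Z x)"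
    proof (intro exI[of _ "ball a r"] conjI ballI)
      show "openin (top_of_set (- closure \<Omega>)) (ball a r)"
        using r(3) by (simp add: open_subset)
      show "a \<in> ball a r" using r(1) by simp
      show "Z a \<longleftrightarrow> Z x" if "x \<in> ball a r" for x
        using spread that r(1) by (meson centre_in_ball)
    qed
  qed auto
  moreover have "Z x0" using x0 unfolding Z_def by blast
  ultimately show ?thesis unfolding Z_def by (meson centre_in_ball)
qed

text \<open>Far-field amplitude in direction \<omega>, of the outgoing part for \<sigma> = 1 and of
  the incoming part for \<sigma> = -1. The factor \<open>cis (\<kappa> * (y \<bullet> m))\<close> is
  what remains of the convective phase once its \<open>x\<close>-dependent part is divided
  out.\<close>

definition plane_wave_integral :: "real \<Rightarrow> real ^ 'n \<Rightarrow> (real ^ 'n \<Rightarrow> complex) \<Rightarrow> complex" where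
  "plane_wave_integral \<sigma> \<omega> h =
     (LINT y|lebesgue_on \<Omega>. cis (\<kappa> * (y \<bullet> m)) * cis (- \<sigma> * \<kappa> * mach_inner m \<omega> y) * h y)"

lemma integrable_cis_mult:
  assumes "integrable (lebesgue_on \<Omega>) h" "continuous_on \<Omega> f"
  shows "integrable (lebesgue_on \<Omega>) (\<lambda>y. cis (f y) * h y)"
proof (rule integrable_bounded_mult[OF assms(1)])
  show "(\<lambda>y. cis (f y)) \<in> borel_measurable (lebesgue_on \<Omega>)"
    using \<Omega>(1) assms(2) by (intro measurable_lebesgue_on_continuous continuous_intros)
qed (auto intro: order_refl)

text \<open>The squared distance is \<open>R^2 - 2 * R * c + d\<close> with constants
  \<open>c\<close> and \<open>d\<close>, and its root expands as \<open>R - c\<close> plus a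
  remainder of order \<open>1 / R\<close>.\<close>

lemma mach_norm_asymptotics:
  assumes "mach_norm m \<omega> = 1"
  shows "((\<lambda>R. mach_norm m (R *\<^sub>R \<omega> - y) - R) \<longlongrightarrow> - mach_inner m \<omega> y) at_top"
    and "((\<lambda>R. R / mach_norm m (R *\<^sub>R \<omega> - y)) \<longlongrightarrow> 1) at_top"
    and "filterlim (\<lambda>R. mach_norm m (R *\<^sub>R \<omega> - y)) at_top at_top"
proof -
  define c d where "c = mach_inner m \<omega> y" and "d = mach_inner m y y"
  have "mach_inner m \<omega> \<omega> = 1" using assms mach_norm_sq[of m \<omega>] by simp
  then have "(mach_norm m (R *\<^sub>R \<omega> - y))\<^sup>2 = R\<^sup>2 - 2 * R * c + d" for R
    unfolding mach_norm_sq c_def d_def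
    by (simp add: mach_inner_simps mach_inner_commute[of m y \<omega>] power2_eq_square algebra_simps)
  then have eq: "mach_norm m (R *\<^sub>R \<omega> - y) = sqrt (R\<^sup>2 - 2 * R * c + d)" for R
    using mach_norm_nonneg by (metis real_sqrt_unique)
  show "((\<lambda>R. mach_norm m (R *\<^sub>R \<omega> - y) - R) \<longlongrightarrow> - mach_inner m \<omega> y) at_top"
    unfolding eq c_def[symmetric] by real_asymp
  show "((\<lambda>R. R / mach_norm m (R *\<^sub>R \<omega> - y)) \<longlongrightarrow> 1) at_top"
    unfolding eq by real_asymp
  show "filterlim (\<lambda>R. mach_norm m (R *\<^sub>R \<omega> - y)) at_top at_top"
    unfolding eq by real_asymp
qed

text \<open>Multiplied by \<open>R powr p\<close> and up to a unimodular factor, the potential at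
  \<open>R *\<^sub>R \<omega>\<close> is nearly a combination of \<open>cis (\<kappa> * R)\<close>
  and \<open>cis (- \<kappa> * R)\<close> whose coefficients are the two left-hand sides. The
  potential is zero and the two oscillations are independent, so both coefficients vanish.\<close>

lemma far_field:
  assumes lim: "((\<lambda>s. of_real (s powr p) * G (of_real (s\<^sup>2)) - (a * cis (\<kappa> * s) + b * cis (- \<kappa> * s))) \<longlongrightarrow> 0) at_top"
    and h: "integrable (lebesgue_on \<Omega>) h"
    and zero: "\<And>x. x \<in> - closure \<Omega> \<Longrightarrow> potential h x = 0"
    and \<omega>: "mach_norm m \<omega> = 1" and p: "p \<ge> 0"
  shows "a * plane_wave_integral 1 \<omega> h = 0" "b * plane_wave_integral (-1) \<omega> h = 0"
proof -
  note \<beta> = mach_beta_pos[OF m]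
  define f where "f = (\<lambda>s. of_real (s powr p) * G (of_real (s\<^sup>2)))"
  define s where "s = (\<lambda>R y. mach_norm m (R *\<^sub>R \<omega> - y))"
  \<comment> \<open>The kernel at \<open>R *\<^sub>R \<omega>\<close> without its convective phase
    and with its decay compensated; \<open>T_bound\<close> supplies the domination for the
    limit.\<close>
  define T where "T = (\<lambda>R y. of_real (R powr p) * G (of_real ((s R y)\<^sup>2)))"
  obtain D where D: "D > 0" "\<And>y. y \<in> closure \<Omega> \<Longrightarrow> norm y \<le> D"
    using bounded_closure[OF \<Omega>(2)] by (meson bounded_pos)
  have "\<forall>\<^sub>F t in at_top. cmod (f t - (a * cis (\<kappa> * t) + b * cis (- \<kappa> * t))) < 1"
    using tendstoD[OF lim, of 1] by (simp add: f_def dist_norm)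
  then obtain s0 where s0: "\<And>t. t \<ge> s0 \<Longrightarrow> cmod (f t - (a * cis (\<kappa> * t) + b * cis (- \<kappa> * t))) < 1"
    by (auto simp: eventually_at_top_linorder)
  have fB: "cmod (f t) \<le> cmod a + cmod b + 1" if "t \<ge> s0" for t
  proof -
    have "cmod (f t) \<le> cmod (f t - (a * cis (\<kappa> * t) + b * cis (- \<kappa> * t))) + cmod (a * cis (\<kappa> * t) + b * cis (- \<kappa> * t))"
      by (metis norm_triangle_sub add.commute)
    also have "cmod (a * cis (\<kappa> * t) + b * cis (- \<kappa> * t)) \<le> cmod a + cmod b"
      by (rule norm_triangle_le) (simp add: norm_mult)
    finally show ?thesis using s0[OF that] by linarith
  qed
  \<comment> \<open>From \<open>2 * D\<close> on, the point \<open>R *\<^sub>R \<omega>\<close> lies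
    off \<open>closure \<Omega>\<close> and at distance at least \<open>R / 2\<close> from \<Omega>;
    from \<open>2 * s0 / mach_beta m\<close> on, the Mach distances reach \<open>s0\<close>; the 1
    makes \<open>R\<close> positive.\<close>
  define R0 where "R0 = Max {2 * D, 2 * s0 / mach_beta m, 1}"
  have R0: "2 * D \<le> R0" "2 * s0 / mach_beta m \<le> R0" "1 \<le> R0"
    unfolding R0_def by (simp_all)
  have norm\<omega>: "1 \<le> norm \<omega>" using mach_norm_le[OF m, of \<omega>] \<omega> by simp
  have s_ge: "mach_beta m * R / 2 \<le> s R y" if "R \<ge> R0" "y \<in> \<Omega>" for R y
  proof -
    have "norm y \<le> D" using D that closure_subset[of \<Omega>] by auto
    moreover have "R * 1 \<le> norm (R *\<^sub>R \<omega>)" using norm\<omega> that R0 by (simp add: mult_left_mono)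
    ultimately have "R / 2 \<le> norm (R *\<^sub>R \<omega>) - norm y" using R0 that by linarith
    also have "\<dots> \<le> norm (R *\<^sub>R \<omega> - y)" by (rule norm_triangle_ineq2)
    finally have "mach_beta m * (R / 2) \<le> mach_beta m * norm (R *\<^sub>R \<omega> - y)" using \<beta> by simp
    then show ?thesis using mach_norm_ge[OF m, of "R *\<^sub>R \<omega> - y"] by (simp add: s_def)
  qed
  have s_pos: "s R y > 0" if "R \<ge> R0" "y \<in> \<Omega>" for R y
    using s_ge[OF that] \<beta> R0 that by (smt (verit) divide_pos_pos mult_pos_pos)
  have T_eq: "T R y = of_real ((R / s R y) powr p) * f (s R y)" if "R \<ge> R0" "y \<in> \<Omega>" for R y
  proof -
    have "R powr p = (R / s R y) powr p * s R y powr p"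
      using s_pos[OF that] R0 that by (simp flip: powr_mult)
    then show ?thesis by (simp add: T_def f_def)
  qed
  have T_bound: "cmod (T R y) \<le> (2 / mach_beta m) powr p * (cmod a + cmod b + 1)"
    if "R \<ge> R0" "y \<in> \<Omega>" for R y
  proof -
    have "R / s R y \<le> 2 / mach_beta m"
      using s_ge[OF that] s_pos[OF that] \<beta> by (simp add: field_simps)
    then have "(R / s R y) powr p \<le> (2 / mach_beta m) powr p"
      using s_pos[OF that] R0 that p by (intro powr_mono2) auto
    moreover have "s0 \<le> s R y"
    proof -
      have "2 * s0 / mach_beta m \<le> R" using R0 that by simp
      then have "s0 \<le> mach_beta m * R / 2" using \<beta> by (simp add: field_simps)
      then show ?thesis using s_ge[OF that] by linarith
    qed
    ultimately show ?thesis
      unfolding T_eq[OF that] norm_mult using fB by (intro mult_mono) auto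
  qed
  have T_int: "(LINT y|lebesgue_on \<Omega>. T R y * (cis (\<kappa> * (y \<bullet> m)) * h y)) = 0" if "R \<ge> R0" for R
  proof -
    have "R * 1 \<le> norm (R *\<^sub>R \<omega>)" using norm\<omega> that R0 by (simp add: mult_left_mono)
    then have "\<not> norm (R *\<^sub>R \<omega>) \<le> D" using D(1) R0 that by linarith
    then have "R *\<^sub>R \<omega> \<in> - closure \<Omega>" using D(2) by blast
    then have "potential h (R *\<^sub>R \<omega>) = 0" by (rule zero)
    moreover have eq: "T R y * (cis (\<kappa> * (y \<bullet> m)) * h y)
        = of_real (R powr p) * cis (\<kappa> * (R *\<^sub>R \<omega> \<bullet> m)) * (kernel (R *\<^sub>R \<omega>) y * h y)" for y
    proof -
      have "cis (\<kappa> * (y \<bullet> m)) = cis (\<kappa> * (R *\<^sub>R \<omega> \<bullet> m)) * cis (- \<kappa> * ((R *\<^sub>R \<omega> - y) \<bullet> m))"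
        by (simp add: cis_mult inner_simps algebra_simps)
      then show ?thesis by (simp add: T_def s_def kernel_def)
    qed
    ultimately show ?thesis
      unfolding eq potential_def by (simp only: integral_mult_right_zero mult_zero_right)
  qed
  have key: "a * cis (\<kappa> * R) * plane_wave_integral 1 \<omega> h + b * cis (- \<kappa> * R) * plane_wave_integral (-1) \<omega> h = 0"
    if "R \<ge> 0" for R
  proof -
    obtain N :: nat where N: "R0 * \<kappa> / (2 * pi) \<le> real N" using real_arch_simple by blast
    \<comment> \<open>Moving out by whole periods freezes \<open>cis (\<kappa> * R)\<close> and
      \<open>cis (- \<kappa> * R)\<close>, so that a limit exists; \<open>N\<close> starts the
      sequence beyond \<open>R0\<close>.\<close>
    define Rn where "Rn = (\<lambda>n. R + 2 * pi * real (n + N) / \<kappa>)"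
    have Rn_ge: "Rn n \<ge> R0" for n
    proof -
      have "R0 * \<kappa> / (2 * pi) \<le> real (n + N)" using N by simp
      then have "R0 \<le> 2 * pi * real (n + N) / \<kappa>" using \<kappa> by (simp add: field_simps)
      then show ?thesis using that by (simp add: Rn_def)
    qed
    have Rn_lim: "filterlim Rn at_top sequentially"
      unfolding Rn_def using \<kappa> by real_asymp
    have cisn: "cis (\<kappa> * Rn n) = cis (\<kappa> * R)" "cis (- \<kappa> * Rn n) = cis (- \<kappa> * R)" for n
    proof -
      have c1: "cis (2 * pi * real (n + N)) = 1" using cis_multiple_2pi[of "real (n + N)"] by simp
      have e: "\<kappa> * Rn n = \<kappa> * R + 2 * pi * real (n + N)" using \<kappa> by (simp add: Rn_def field_simps)
      show 1: "cis (\<kappa> * Rn n) = cis (\<kappa> * R)" unfolding e cis_mult[symmetric] c1 by simp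
      show "cis (- \<kappa> * Rn n) = cis (- \<kappa> * R)" using 1 by (simp add: cis_inverse[symmetric] flip: cis_inverse)
    qed
    let ?g = "\<lambda>y. a * cis (\<kappa> * R) * cis (- 1 * \<kappa> * mach_inner m \<omega> y)
        + b * cis (- \<kappa> * R) * cis (- (-1) * \<kappa> * mach_inner m \<omega> y)"
    have T_lim: "(\<lambda>n. T (Rn n) y) \<longlonglongrightarrow> ?g y" if "y \<in> \<Omega>" for y
    proof -
      have 1: "(\<lambda>n. s (Rn n) y - Rn n) \<longlonglongrightarrow> - mach_inner m \<omega> y"
        using filterlim_compose[OF mach_norm_asymptotics(1)[OF \<omega>] Rn_lim] by (simp add: s_def)
      have 2: "(\<lambda>n. Rn n / s (Rn n) y) \<longlonglongrightarrow> 1"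
        using filterlim_compose[OF mach_norm_asymptotics(2)[OF \<omega>] Rn_lim] by (simp add: s_def)
      have 3: "filterlim (\<lambda>n. s (Rn n) y) at_top sequentially"
        using filterlim_compose[OF mach_norm_asymptotics(3)[OF \<omega>] Rn_lim] by (simp add: s_def)
      have c: "cis (\<kappa> * s (Rn n) y) = cis (\<kappa> * R) * cis (\<kappa> * (s (Rn n) y - Rn n))"
        "cis (- \<kappa> * s (Rn n) y) = cis (- \<kappa> * R) * cis (- \<kappa> * (s (Rn n) y - Rn n))" for n
        unfolding cisn(1)[of n, symmetric] cisn(2)[of n, symmetric] by (simp_all add: cis_mult algebra_simps)
      have cc: "((\<lambda>n. cis (x n)) \<longlongrightarrow> cis l) F" if "(x \<longlongrightarrow> l) F" for x :: "nat \<Rightarrow> real" and l F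
        using isCont_tendsto_compose[OF _ that, of cis] continuous_on_cis[OF continuous_on_id, of UNIV]
        by (simp add: continuous_on_eq_continuous_at)
      have 4: "(\<lambda>n. a * cis (\<kappa> * s (Rn n) y) + b * cis (- \<kappa> * s (Rn n) y))
         \<longlonglongrightarrow> a * (cis (\<kappa> * R) * cis (\<kappa> * - mach_inner m \<omega> y)) + b * (cis (- \<kappa> * R) * cis (- \<kappa> * - mach_inner m \<omega> y))"
        unfolding c by (intro tendsto_intros cc 1)
      have "(\<lambda>n. f (s (Rn n) y) - (a * cis (\<kappa> * s (Rn n) y) + b * cis (- \<kappa> * s (Rn n) y))) \<longlonglongrightarrow> 0"
        using filterlim_compose[OF lim 3] by (simp add: f_def)
      from tendsto_add[OF this 4] have 5: "(\<lambda>n. f (s (Rn n) y)) \<longlonglongrightarrow> ?g y"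
        by (simp add: mult.assoc)
      have "(\<lambda>n. of_real ((Rn n / s (Rn n) y) powr p) * f (s (Rn n) y)) \<longlonglongrightarrow> of_real (1 powr p) * ?g y"
        by (intro tendsto_mult 5 tendsto_of_real tendsto_powr 2 tendsto_const) auto
      then show ?thesis using T_eq[OF Rn_ge that] by simp
    qed
    have "(\<lambda>n. LINT y|lebesgue_on \<Omega>. T (Rn n) y * (cis (\<kappa> * (y \<bullet> m)) * h y))
        \<longlonglongrightarrow> (LINT y|lebesgue_on \<Omega>. ?g y * (cis (\<kappa> * (y \<bullet> m)) * h y))"
    proof (rule integral_dominated_convergence[where
          w = "\<lambda>y. (2 / mach_beta m) powr p * (cmod a + cmod b + 1) * cmod (h y)"])
      have h': "(\<lambda>y. cis (\<kappa> * (y \<bullet> m)) * h y) \<in> borel_measurable (lebesgue_on \<Omega>)"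
        by (intro borel_measurable_integrable integrable_cis_mult h continuous_intros)
      have "?g \<in> borel_measurable (lebesgue_on \<Omega>)"
        using \<Omega>(1) by (intro measurable_lebesgue_on_continuous) (auto simp: mach_inner_def intro!: continuous_intros)
      then show "(\<lambda>y. ?g y * (cis (\<kappa> * (y \<bullet> m)) * h y)) \<in> borel_measurable (lebesgue_on \<Omega>)"
        using h' by (rule borel_measurable_times)
      have "T (Rn n) \<in> borel_measurable (lebesgue_on \<Omega>)" for n
      proof (rule measurable_lebesgue_on_continuous[OF \<Omega>(1)])
        have "continuous_on \<Omega> (\<lambda>y. G (of_real ((s (Rn n) y)\<^sup>2)))"
        proof (rule continuous_on_compose2[OF holomorphic_on_imp_continuous_on[OF G]])
          show "continuous_on \<Omega> (\<lambda>y. complex_of_real ((s (Rn n) y)\<^sup>2))"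
            unfolding s_def mach_norm_def by (intro continuous_intros)
          have "s (Rn n) y \<noteq> 0" if "y \<in> \<Omega>" for y
            using s_pos[OF Rn_ge that, of n] by simp
          then show "(\<lambda>y. complex_of_real ((s (Rn n) y)\<^sup>2)) ` \<Omega> \<subseteq> {z. 0 < Re z}"
            by (auto simp flip: of_real_power)
        qed
        then show "continuous_on \<Omega> (T (Rn n))" unfolding T_def by (intro continuous_intros)
      qed
      then show "(\<lambda>y. T (Rn n) y * (cis (\<kappa> * (y \<bullet> m)) * h y)) \<in> borel_measurable (lebesgue_on \<Omega>)" for n
        by (rule borel_measurable_times[OF _ h'])
      show "integrable (lebesgue_on \<Omega>) (\<lambda>y. (2 / mach_beta m) powr p * (cmod a + cmod b + 1) * cmod (h y))"
        using h by simp
      show "AE y in lebesgue_on \<Omega>. (\<lambda>n. T (Rn n) y * (cis (\<kappa> * (y \<bullet> m)) * h y)) \<longlonglongrightarrow> ?g y * (cis (\<kappa> * (y \<bullet> m)) * h y)"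
        by (intro AE_I2 tendsto_mult_right T_lim) simp
      show "AE y in lebesgue_on \<Omega>. cmod (T (Rn n) y * (cis (\<kappa> * (y \<bullet> m)) * h y))
          \<le> (2 / mach_beta m) powr p * (cmod a + cmod b + 1) * cmod (h y)" for n
        using T_bound[OF Rn_ge] by (intro AE_I2) (auto simp: norm_mult intro!: mult_right_mono)
    qed
    then have "(LINT y|lebesgue_on \<Omega>. ?g y * (cis (\<kappa> * (y \<bullet> m)) * h y)) = 0"
      unfolding T_int[OF Rn_ge] by (simp add: LIMSEQ_const_iff)
    moreover have "(LINT y|lebesgue_on \<Omega>. ?g y * (cis (\<kappa> * (y \<bullet> m)) * h y))
       = (LINT y|lebesgue_on \<Omega>. a * cis (\<kappa> * R) * (cis (\<kappa> * (y \<bullet> m)) * cis (- 1 * \<kappa> * mach_inner m \<omega> y) * h y)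
         + b * cis (- \<kappa> * R) * (cis (\<kappa> * (y \<bullet> m)) * cis (- (-1) * \<kappa> * mach_inner m \<omega> y) * h y))"
      by (rule Bochner_Integration.integral_cong) (auto simp: algebra_simps)
    moreover have int: "integrable (lebesgue_on \<Omega>) (\<lambda>y. cis (\<kappa> * (y \<bullet> m)) * cis (\<sigma> * \<kappa> * mach_inner m \<omega> y) * h y)" for \<sigma>
      unfolding cis_mult by (rule integrable_cis_mult[OF h]) (auto simp: mach_inner_def intro!: continuous_intros)
    ultimately show ?thesis
      unfolding plane_wave_integral_def
      using Bochner_Integration.integral_add[OF
          integrable_mult_right[OF int[of "- 1"], of "a * cis (\<kappa> * R)"]
          integrable_mult_right[OF int[of "- (- 1)"], of "b * cis (- \<kappa> * R)"]]
      by (simp only: integral_mult_right_zero)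
  qed
  \<comment> \<open>The phases at \<open>R = 0\<close> and at a quarter period,
    \<open>R = pi / (2 * \<kappa>)\<close>, give two independent equations.\<close>
  define X Y where "X = a * plane_wave_integral 1 \<omega> h" and "Y = b * plane_wave_integral (-1) \<omega> h"
  have "X + Y = 0" using key[of 0] by (simp add: X_def Y_def)
  moreover have "\<i> * (X - Y) = 0"
    using key[of "pi / (2 * \<kappa>)"] \<kappa> by (simp add: X_def Y_def algebra_simps flip: cis_inverse)
  then have "X - Y = 0" by simp
  ultimately have "X = 0" "Y = 0" by auto
  then show "a * plane_wave_integral 1 \<omega> h = 0" "b * plane_wave_integral (-1) \<omega> h = 0"
    by (simp_all add: X_def Y_def)
qed

end

section \<open>Uniqueness for the Fourier transform\<close>

inductive trig_poly :: "('a::real_inner \<Rightarrow> complex) \<Rightarrow> bool" where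
  wave: "trig_poly (\<lambda>x. c * cis (\<xi> \<bullet> x))"
| add: "trig_poly f \<Longrightarrow> trig_poly g \<Longrightarrow> trig_poly (\<lambda>x. f x + g x)"

lemma trig_poly_mult_wave: "trig_poly g \<Longrightarrow> trig_poly (\<lambda>x. c * cis (\<xi> \<bullet> x) * g x)"
proof (induction rule: trig_poly.induct)
  case (wave c' \<xi>')
  have "(\<lambda>x. c * cis (\<xi> \<bullet> x) * (c' * cis (\<xi>' \<bullet> x))) = (\<lambda>x. (c * c') * cis ((\<xi> + \<xi>') \<bullet> x))"
    by (auto simp: inner_add_left simp flip: cis_mult)
  then show ?case using trig_poly.wave by metis
next
  case (add f g)
  then show ?case using trig_poly.add by (fastforce simp: distrib_left)
qed

lemma trig_poly_mult:
  assumes "trig_poly f" "trig_poly g"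
  shows "trig_poly (\<lambda>x. f x * g x)"
  using assms(1)
proof (induction rule: trig_poly.induct)
  case (wave c \<xi>)
  show ?case by (rule trig_poly_mult_wave[OF assms(2)])
next
  case (add f1 f2)
  then show ?case using trig_poly.add by (fastforce simp: distrib_right)
qed

lemma trig_poly_continuous: "trig_poly f \<Longrightarrow> continuous_on S f"
  by (induction rule: trig_poly.induct) (intro continuous_intros; assumption)+

lemma trig_poly_const: "trig_poly (\<lambda>x. c)"
  using trig_poly.wave[of c 0] by simp

lemma trig_poly_cos: "trig_poly (\<lambda>x. of_real (cos (\<xi> \<bullet> x)))"
proof -
  have "(\<lambda>x. of_real (cos (\<xi> \<bullet> x))) = (\<lambda>x. 1/2 * cis (\<xi> \<bullet> x) + 1/2 * cis (- \<xi> \<bullet> x))"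
    by (auto simp: complex_eq_iff)
  then show ?thesis using trig_poly.add[OF trig_poly.wave trig_poly.wave] by metis
qed

lemma trig_poly_sin: "trig_poly (\<lambda>x. of_real (sin (\<xi> \<bullet> x)))"
proof -
  have "(\<lambda>x. of_real (sin (\<xi> \<bullet> x))) = (\<lambda>x. (- \<i>/2) * cis (\<xi> \<bullet> x) + \<i>/2 * cis (- \<xi> \<bullet> x))"
    by (auto simp: complex_eq_iff)
  then show ?thesis using trig_poly.add[OF trig_poly.wave trig_poly.wave] by metis
qed

text \<open>Stone-Weierstrass for the real functions whose complexification is a trigonometric
  polynomial: they form an algebra with constants, and a sine or a cosine separates two given
  points.\<close>

lemma trig_poly_dense:
  fixes f :: "'a::real_inner \<Rightarrow> real"
  assumes "compact S" "continuous_on S f" "0 < e"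
  shows "\<exists>g. trig_poly (\<lambda>x. of_real (g x)) \<and> (\<forall>x\<in>S. \<bar>f x - g x\<bar> < e)"
proof (rule Stone_Weierstrass_HOL[OF assms(1) _ _ _ _ _ assms(2,3)])
  fix g :: "'a \<Rightarrow> real" assume "trig_poly (\<lambda>x. of_real (g x))"
  then have "continuous_on S (\<lambda>x. Re (of_real (g x)))"
    by (intro continuous_intros trig_poly_continuous)
  then show "continuous_on S g" by simp
next
  fix x y :: 'a assume xy: "x \<in> S \<and> y \<in> S \<and> x \<noteq> y"
  \<comment> \<open>Scaled so that the phases at \<open>x\<close> and \<open>y\<close> differ by
    exactly 1, which is not a multiple of \<open>2 * pi\<close>.\<close>
  define \<xi> where "\<xi> = (1 / ((x - y) \<bullet> (x - y))) *\<^sub>R (x - y)"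
  have "\<xi> \<bullet> (x - y) = 1" using xy by (simp add: \<xi>_def)
  then have "\<xi> \<bullet> x = \<xi> \<bullet> y + 1" by (simp add: inner_diff_right)
  then have "cis (\<xi> \<bullet> x) = cis (\<xi> \<bullet> y) * cis 1" by (simp add: cis_mult)
  moreover have "cis 1 \<noteq> 1"
    using sin_gt_zero[of 1] pi_gt3 by (auto simp: complex_eq_iff)
  ultimately have "cis (\<xi> \<bullet> x) \<noteq> cis (\<xi> \<bullet> y)" by simp
  then consider "cos (\<xi> \<bullet> x) \<noteq> cos (\<xi> \<bullet> y)" | "sin (\<xi> \<bullet> x) \<noteq> sin (\<xi> \<bullet> y)"
    by (auto simp: complex_eq_iff)
  then show "\<exists>f. trig_poly (\<lambda>x. of_real (f x)) \<and> f x \<noteq> f y"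
  proof cases
    case 1
    then show ?thesis using trig_poly_cos by (intro exI[of _ "\<lambda>x. cos (\<xi> \<bullet> x)"]) simp
  next
    case 2
    then show ?thesis using trig_poly_sin by (intro exI[of _ "\<lambda>x. sin (\<xi> \<bullet> x)"]) simp
  qed
qed (auto simp: trig_poly_const intro: trig_poly.add trig_poly_mult)

text \<open>A closed \<open>C\<close> inside the set \<open>E\<close> where \<open>u\<close> is
  positive must be null, since a positive function has integral 0 over it; inner regularity then
  makes \<open>E\<close> null.\<close>

lemma AE_nonpos_if_closed_integrals_zero:
  fixes u :: "'a::euclidean_space \<Rightarrow> real"
  assumes \<Omega>: "\<Omega> \<in> sets lebesgue" and u: "integrable (lebesgue_on \<Omega>) u"
    and zero: "\<And>C. closed C \<Longrightarrow> (LINT y|lebesgue_on \<Omega>. indicator C y * u y) = 0"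
  shows "AE y in lebesgue_on \<Omega>. u y \<le> 0"
proof -
  define E where "E = {y \<in> \<Omega>. u y > 0}"
  have "E \<in> sets (lebesgue_on \<Omega>)"
    using borel_measurable_integrable[OF u] borel_measurable_iff_greater[of u "lebesgue_on \<Omega>"]
    by (simp add: E_def space_restrict_space)
  then have E: "E \<in> sets lebesgue"
    using \<Omega> sets_restrict_space_iff[of \<Omega> lebesgue] by auto
  have "emeasure lebesgue E \<le> ennreal e" if e: "e > 0" for e
  proof -
    obtain C where C: "closed C" "C \<subseteq> E" "E - C \<in> lmeasurable" "emeasure lebesgue (E - C) < ennreal e"
      using sets_lebesgue_inner_closed[OF E e] by blast
    have CE: "C \<in> sets lebesgue" using borel_closed[OF C(1)] by (metis sets_completionI_sets sets_lborel)
    have CS: "C \<in> sets (lebesgue_on \<Omega>)"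
      using CE C(2) \<Omega> by (auto simp: sets_restrict_space_iff E_def)
    have int: "integrable (lebesgue_on \<Omega>) (\<lambda>y. indicator C y * u y)"
      using integrable_real_mult_indicator[OF CS u] by (simp add: mult.commute)
    have "AE y in lebesgue_on \<Omega>. 0 \<le> indicator C y * u y"
      using C(2) by (intro AE_I2) (auto simp: E_def indicator_def less_imp_le)
    from integral_nonneg_eq_0_iff_AE[OF int this, THEN iffD1, OF zero[OF C(1)]]
    have "AE y in lebesgue_on \<Omega>. indicator C y * u y = 0" .
    then have "AE y in lebesgue_on \<Omega>. y \<notin> C"
      by eventually_elim (use C(2) in \<open>auto simp: E_def indicator_def\<close>)
    then have "AE y in lebesgue. y \<notin> C"
      using \<Omega> C(2) by (subst (asm) AE_restrict_space_iff) (auto simp: E_def)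
    then have "emeasure lebesgue C = 0"
      using CE by (subst (asm) AE_iff_measurable[of C]) auto
    moreover have "emeasure lebesgue E \<le> emeasure lebesgue C + emeasure lebesgue (E - C)"
      using emeasure_subadditive[of C lebesgue "E - C"] CE C E
      by (metis Un_Diff_cancel fmeasurableD sup.absorb2)
    ultimately show ?thesis using C(4) by (simp add: less_imp_le order.trans)
  qed
  then have "emeasure lebesgue E = 0"
    by (metis ennreal_le_epsilon add_0 ennreal_0 le_zero_eq zero_le)
  then have "AE y in lebesgue. y \<notin> E" using E by (subst AE_iff_measurable[of E]) auto
  then have "AE y in lebesgue. y \<in> \<Omega> \<longrightarrow> u y \<le> 0"
    by eventually_elim (auto simp: E_def)
  then show ?thesis using \<Omega> by (subst AE_restrict_space_iff) auto
qed

text \<open>The vanishing of the integral spreads from waves to trigonometric polynomials, by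
  density to continuous functions on the compact \<open>closure \<Omega>\<close>, and by pointwise
  limits to indicators of closed sets. These determine the signs of the real and imaginary
  parts.\<close>

lemma fourier_uniqueness:
  fixes q :: "'a::euclidean_space \<Rightarrow> complex"
  assumes \<Omega>: "open \<Omega>" "bounded \<Omega>" and q: "integrable (lebesgue_on \<Omega>) q"
    and zero: "\<And>\<xi>. (LINT y|lebesgue_on \<Omega>. cis (\<xi> \<bullet> y) * q y) = 0"
  shows "AE y in lebesgue_on \<Omega>. q y = 0"
proof -
  have sp: "space (lebesgue_on \<Omega>) = \<Omega>" by (simp add: space_restrict_space)
  have cont_int: "integrable (lebesgue_on \<Omega>) (\<lambda>y. f y * q y)" 
    if "continuous_on (closure \<Omega>) f" for f :: "'a \<Rightarrow> complex"
  proof -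
    have "compact (f ` closure \<Omega>)" using \<Omega> that by (intro compact_continuous_image) auto
    then obtain B where "\<forall>z \<in> f ` closure \<Omega>. cmod z \<le> B"
      using compact_imp_bounded bounded_iff by metis
    moreover have "f \<in> borel_measurable (lebesgue_on \<Omega>)"
      using \<Omega>(1) continuous_on_subset[OF that closure_subset]
      by (intro continuous_imp_measurable_on_sets_lebesgue) auto
    ultimately show ?thesis
      using closure_subset[of \<Omega>] by (intro integrable_bounded_mult[OF q]) (auto simp: sp)
  qed
  have trig: "(LINT y|lebesgue_on \<Omega>. f y * q y) = 0" if "trig_poly f" for f
    using that
  proof (induction rule: trig_poly.induct)
    case (wave c \<xi>)
    then show ?case using zero[of \<xi>] by (simp add: mult.assoc)
  next
    case (add f g)
    then show ?case
      by (simp add: distrib_right Bochner_Integration.integral_add cont_int trig_poly_continuous)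
  qed
  have cont: "(LINT y|lebesgue_on \<Omega>. of_real (f y) * q y) = 0"
    if f: "continuous_on (closure \<Omega>) f" for f :: "'a \<Rightarrow> real"
  proof -
    let ?I = "LINT y|lebesgue_on \<Omega>. cmod (q y)"
    have "cmod (LINT y|lebesgue_on \<Omega>. of_real (f y) * q y) \<le> e * (?I + 1)" if "e > 0" for e
    proof -
      obtain g where g: "trig_poly (\<lambda>x. of_real (g x))" "\<And>x. x \<in> closure \<Omega> \<Longrightarrow> \<bar>f x - g x\<bar> < e"
        using trig_poly_dense[OF _ f \<open>e > 0\<close>] \<Omega> by (metis compact_closure)
      have int: "integrable (lebesgue_on \<Omega>) (\<lambda>y. of_real (f y) * q y)"
        "integrable (lebesgue_on \<Omega>) (\<lambda>y. of_real (g y) * q y)"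
        using f trig_poly_continuous[OF g(1)] by (auto intro!: cont_int continuous_intros)
      have "(LINT y|lebesgue_on \<Omega>. of_real (f y) * q y) = (LINT y|lebesgue_on \<Omega>. (of_real (f y) * q y - of_real (g y) * q y))"
        using Bochner_Integration.integral_diff[OF int] trig[OF g(1)] by simp
      also have "cmod \<dots> \<le> (LINT y|lebesgue_on \<Omega>. e * cmod (q y))"
      proof (rule order.trans[OF integral_norm_bound integral_mono])
        show "integrable (lebesgue_on \<Omega>) (\<lambda>y. cmod (of_real (f y) * q y - of_real (g y) * q y))"
          using int by (intro integrable_norm) simp
        show "integrable (lebesgue_on \<Omega>) (\<lambda>y. e * cmod (q y))" using q by simp
        show "cmod (of_real (f y) * q y - of_real (g y) * q y) \<le> e * cmod (q y)"
          if "y \<in> space (lebesgue_on \<Omega>)" for y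
        proof -
          have "cmod (of_real (f y) * q y - of_real (g y) * q y) = \<bar>f y - g y\<bar> * cmod (q y)"
            by (metis left_diff_distrib norm_mult norm_of_real of_real_diff)
          also have "\<dots> \<le> e * cmod (q y)"
            using g(2)[of y] that closure_subset[of \<Omega>] by (intro mult_right_mono) (auto simp: sp)
          finally show ?thesis .
        qed
      qed
      also have "\<dots> = e * ?I" by simp
      also have "\<dots> \<le> e * (?I + 1)" using that by simp
      finally show ?thesis .
    qed
    note bound = this
    have "0 \<le> ?I" by (rule Bochner_Integration.integral_nonneg) simp
    have "cmod (LINT y|lebesgue_on \<Omega>. of_real (f y) * q y) \<le> 0"
    proof (rule field_le_epsilon)
      fix e :: real assume "e > 0"
      then show "cmod (LINT y|lebesgue_on \<Omega>. of_real (f y) * q y) \<le> 0 + e"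
        using bound[of "e / (?I + 1)"] \<open>0 \<le> ?I\<close> by simp
    qed
    then show ?thesis by simp
  qed
  have closed: "(LINT y|lebesgue_on \<Omega>. of_real (indicator C y) * q y) = 0" if "closed C" for C
  proof (cases "C = {}")
    case False
    \<comment> \<open>Continuous cut-offs that are 1 on \<open>C\<close> and, for positive
      \<open>n\<close>, 0 at distance at least \<open>1 / n\<close>; they decrease to the indicator
      because \<open>C\<close> is closed.\<close>
    define f where "f = (\<lambda>n y. max 0 (1 - real n * infdist y C))"
    have fc: "continuous_on S (f n)" for n S
      unfolding f_def by (intro continuous_intros)
    have f01: "0 \<le> f n y" "f n y \<le> 1" for n y
      using infdist_nonneg[of y C] by (auto simp: f_def)
    have "(\<lambda>n. LINT y|lebesgue_on \<Omega>. of_real (f n y) * q y) \<longlonglongrightarrow> (LINT y|lebesgue_on \<Omega>. of_real (indicator C y) * q y)"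
    proof (rule integral_dominated_convergence[where w = "\<lambda>y. cmod (q y)"])
      have "indicator C \<in> borel_measurable (lebesgue_on \<Omega>)"
        using that by (intro borel_measurable_indicator' measurable_restrict_space1) auto
      then show "(\<lambda>y. of_real (indicator C y) * q y) \<in> borel_measurable (lebesgue_on \<Omega>)"
        using q by measurable
      show "(\<lambda>y. of_real (f n y) * q y) \<in> borel_measurable (lebesgue_on \<Omega>)" for n
        by (intro borel_measurable_integrable cont_int continuous_intros fc)
      show "integrable (lebesgue_on \<Omega>) (\<lambda>y. cmod (q y))" using q by simp
      show "AE y in lebesgue_on \<Omega>. cmod (of_real (f n y) * q y) \<le> cmod (q y)" for n
        using f01 by (intro AE_I2) (auto simp: norm_mult intro!: mult_left_le_one_le)
      have "(\<lambda>n. f n y) \<longlonglongrightarrow> indicator C y" for y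
      proof (cases "y \<in> C")
        case True
        then show ?thesis using False that by (simp add: f_def)
      next
        case ne: False
        then have "infdist y C > 0"
          using False that in_closed_iff_infdist_zero[of C y] infdist_nonneg[of y C] by fastforce
        then have "\<forall>\<^sub>F n in sequentially. 1 < real n * infdist y C" by real_asymp
        then have "\<forall>\<^sub>F n in sequentially. f n y = indicator C y"
          by eventually_elim (use ne in \<open>auto simp: f_def\<close>)
        then show ?thesis by (rule tendsto_eventually)
      qed
      then show "AE y in lebesgue_on \<Omega>. (\<lambda>n. of_real (f n y) * q y) \<longlonglongrightarrow> of_real (indicator C y) * q y"
        by (intro AE_I2 tendsto_intros)
    qed
    then show ?thesis using cont[OF fc] by (simp add: LIMSEQ_const_iff)
  qed simp
  have ind_int: "integrable (lebesgue_on \<Omega>) (\<lambda>y. of_real (indicator C y) * q y)" if "closed C" for C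
  proof (rule integrable_bounded_mult[OF q])
    have "indicator C \<in> borel_measurable (lebesgue_on \<Omega>)"
      using that by (intro borel_measurable_indicator' measurable_restrict_space1) auto
    then show "(\<lambda>y. complex_of_real (indicator C y)) \<in> borel_measurable (lebesgue_on \<Omega>)"
      by measurable
    show "cmod (complex_of_real (indicator C y)) \<le> 1" for y by (simp add: indicator_def)
  qed
  have L: "\<Omega> \<in> sets lebesgue" using \<Omega> by simp
  have part: "AE y in lebesgue_on \<Omega>. P (q y) \<le> 0"
    if P: "bounded_linear P" and Pm: "\<And>c z. P (of_real c * z) = c * P z" for P :: "complex \<Rightarrow> real"
  proof (rule AE_nonpos_if_closed_integrals_zero[OF L])
    show "integrable (lebesgue_on \<Omega>) (\<lambda>y. P (q y))" by (rule integrable_bounded_linear[OF P q])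
    show "(LINT y|lebesgue_on \<Omega>. indicator C y * P (q y)) = 0" if "closed C" for C
      using integral_bounded_linear[OF P ind_int[OF that]] closed[OF that] bounded_linear.linear[OF P]
      by (simp add: Pm linear_0)
  qed
  have "AE y in lebesgue_on \<Omega>. Re (q y) \<le> 0" "AE y in lebesgue_on \<Omega>. - Re (q y) \<le> 0"
    "AE y in lebesgue_on \<Omega>. Im (q y) \<le> 0" "AE y in lebesgue_on \<Omega>. - Im (q y) \<le> 0"
    by (rule part; auto intro: bounded_linear_Re bounded_linear_Im bounded_linear_minus)+
  then show ?thesis by eventually_elim (auto simp: complex_eq_iff)
qed

section \<open>Injectivity\<close>

text \<open>The points of \<open>S\<close> where \<open>f\<close> differs from \<open>c\<close> form
  an open set, and a negligible open set is empty.\<close>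

lemma continuous_AE_zero:
  fixes f :: "'a::euclidean_space \<Rightarrow> 'b::t1_space"
  assumes "open S" "S \<subseteq> M" "M \<in> sets lebesgue" "continuous_on S f"
    and "AE x in lebesgue_on M. x \<in> S \<longrightarrow> f x = c"
    and "x \<in> S"
  shows "f x = c"
proof (rule ccontr)
  assume "f x \<noteq> c"
  define T where "T = {x \<in> S. f x \<noteq> c}"
  have "T = S \<inter> f -` (- {c})" by (auto simp: T_def)
  then have "open T"
    using continuous_open_preimage[OF assms(4,1), of "- {c}"] by (simp add: open_Compl)
  moreover have "T \<noteq> {}" using \<open>f x \<noteq> c\<close> assms(6) by (auto simp: T_def)
  ultimately have "\<not> negligible T" using open_not_negligible by blast
  moreover have "AE x in lebesgue. x \<in> M \<longrightarrow> x \<in> S \<longrightarrow> f x = c"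
    using assms(3,5) by (subst (asm) AE_restrict_space_iff) auto
  then have "AE x in lebesgue. x \<notin> T"
    by eventually_elim (use assms(2) in \<open>auto simp: T_def\<close>)
  then have "negligible T"
    by (simp add: negligible_iff_null_sets AE_iff_null_sets \<open>open T\<close>)
  ultimately show False by blast
qed

lemma Linf_fun_integrable:
  assumes "q \<in> Linf_fun S" "S \<in> lmeasurable"
  shows "integrable (lebesgue_on S) q"
proof -
  interpret finite_measure "lebesgue_on S"
    using assms(2) by (simp add: finite_measure_lebesgue_on)
  show ?thesis
    using assms(1) by (auto simp: Linf_fun_def intro: integrable_const_bound)
qed

text \<open>\<open>p\<close> is the decay exponent of the kernel, 1 in dimension 3 and 1/2 in
  dimension 2; \<open>a\<close> and \<open>b\<close> are the coefficients of its outgoing and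
  incoming parts.\<close>

locale scattering_kernel = radial_kernel +
  fixes p :: real and a b :: complex
  assumes asymptotics: "((\<lambda>s. of_real (s powr p) * G (of_real (s\<^sup>2))
        - (a * cis (\<kappa> * s) + b * cis (- \<kappa> * s))) \<longlongrightarrow> 0) at_top"
    and p: "p \<ge> 0" and ab: "a \<noteq> 0 \<or> b \<noteq> 0"
    and conn: "connected (- closure \<Omega>)"
    and dim: "2 \<le> CARD('a)"
begin

text \<open>The order of quantifiers is the point: \<sigma> is chosen from \<open>a\<close> and
  \<open>b\<close> alone, so the same sign serves every density \<open>h\<close>, in particular both
  variables of the covariance.\<close>

lemma plane_wave_integral_zero:
  obtains \<sigma> where "\<sigma> = 1 \<or> \<sigma> = -1"
    "\<And>h x0 e \<omega>. integrable (lebesgue_on \<Omega>) h \<Longrightarrow> ball x0 e \<subseteq> - closure \<Omega> \<Longrightarrow> e > 0 \<Longrightarrow>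
       (\<And>x. x \<in> ball x0 e \<Longrightarrow> potential h x = 0) \<Longrightarrow> mach_norm m \<omega> = 1 \<Longrightarrow>
       plane_wave_integral \<sigma> \<omega> h = 0"
proof -
  have *: "a * plane_wave_integral 1 \<omega> h = 0" "b * plane_wave_integral (-1) \<omega> h = 0"
    if "integrable (lebesgue_on \<Omega>) h" "ball x0 e \<subseteq> - closure \<Omega>" "e > 0"
       "\<And>x. x \<in> ball x0 e \<Longrightarrow> potential h x = 0" "mach_norm m \<omega> = 1" for h x0 e \<omega>
  proof -
    have "x0 \<in> - closure \<Omega>" using that(2,3) centre_in_ball by blast
    then have "potential h x = 0" if "x \<in> - closure \<Omega>" for x
      using potential_unique_continuation[OF conn \<open>integrable (lebesgue_on \<Omega>) h\<close> _ \<open>e > 0\<close>] that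
        \<open>\<And>x. x \<in> ball x0 e \<Longrightarrow> potential h x = 0\<close> by blast
    then show "a * plane_wave_integral 1 \<omega> h = 0" "b * plane_wave_integral (-1) \<omega> h = 0"
      using far_field[OF asymptotics that(1) _ that(5) p] by blast+
  qed
  show thesis
  proof (cases "a = 0")
    case False
    then show ?thesis using *(1) by (intro that[of 1]) auto
  next
    case True
    then show ?thesis using *(2) ab by (intro that[of "-1"]) auto
  qed
qed

lemma integrable_kernel_mult:
  assumes "x \<notin> closure \<Omega>" "integrable (lebesgue_on \<Omega>) h"
  shows "integrable (lebesgue_on \<Omega>) (\<lambda>y. kernel x y * h y)"
    and "integrable (lebesgue_on \<Omega>) (\<lambda>y. cnj (kernel x y) * h y)"
proof -
  obtain B where "\<And>z y. z \<in> {x} \<Longrightarrow> y \<in> \<Omega> \<Longrightarrow> cmod (kernel z y) \<le> B"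
    by (rule kernel_bounded[of "{x}"]) (use assms(1) in auto)
  then have B: "\<And>y. y \<in> \<Omega> \<Longrightarrow> cmod (kernel x y) \<le> B" by simp
  have meas: "kernel x \<in> borel_measurable (lebesgue_on \<Omega>)"
    using assms(1) closure_subset[of \<Omega>] by (intro kernel_measurable) auto
  show "integrable (lebesgue_on \<Omega>) (\<lambda>y. kernel x y * h y)"
    using B by (intro integrable_bounded_mult[OF assms(2) meas]) auto
  have "(\<lambda>y. cnj (kernel x y)) \<in> borel_measurable (lebesgue_on \<Omega>)"
    by (rule borel_measurable_continuous_on[OF continuous_on_cnj[OF continuous_on_id] meas])
  then show "integrable (lebesgue_on \<Omega>) (\<lambda>y. cnj (kernel x y) * h y)"
    using B by (intro integrable_bounded_mult[OF assms(2)]) auto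
qed

section \<open>The covariance and its two far-field limits\<close>

definition covariance :: "(real ^ 'a \<Rightarrow> complex) \<Rightarrow> real ^ 'a \<Rightarrow> real ^ 'a \<Rightarrow> complex" where
  "covariance q x1 x2 = (LINT y|lebesgue_on \<Omega>. kernel x1 y * q y * cnj (kernel x2 y))"

lemma covariance_left: "covariance q x1 x2 = potential (\<lambda>y. cnj (kernel x2 y) * q y) x1"
  by (simp add: covariance_def potential_def mult_ac)

lemma covariance_right: "covariance q x1 x2 = cnj (potential (\<lambda>y. cnj (kernel x1 y * q y)) x2)"
  by (simp add: covariance_def potential_def mult_ac flip: Bochner_Integration.integral_cnj)

text \<open>With \<open>x2\<close> fixed the covariance is a potential in \<open>x1\<close>, so its
  far field vanishes for every \<open>x2\<close> in the ball. The conjugate of this far field is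
  again a potential, now in \<open>x2\<close>, with density
  \<open>cnj (E \<omega>1 y * q y)\<close>; its own far field leaves \<open>E \<omega>1\<close>
  times the conjugate of \<open>E \<omega>2\<close>, where the convective phases cancel.\<close>

lemma plane_wave_products:
  assumes q: "integrable (lebesgue_on \<Omega>) q" and B: "ball x0 e \<subseteq> - closure \<Omega>" "e > 0"
    and zero: "\<And>x1 x2. x1 \<in> ball x0 e \<Longrightarrow> x2 \<in> ball x0 e \<Longrightarrow> covariance q x1 x2 = 0"
  obtains \<sigma> where "\<sigma> = 1 \<or> \<sigma> = -1"
    "\<And>\<omega>1 \<omega>2. mach_norm m \<omega>1 = 1 \<Longrightarrow> mach_norm m \<omega>2 = 1 \<Longrightarrow>
      (LINT y|lebesgue_on \<Omega>. cis (\<sigma> * \<kappa> * mach_inner m (\<omega>2 - \<omega>1) y) * q y) = 0"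
proof -
  obtain \<sigma> where \<sigma>: "\<sigma> = 1 \<or> \<sigma> = -1" and
    pw: "\<And>h x0 e \<omega>. integrable (lebesgue_on \<Omega>) h \<Longrightarrow> ball x0 e \<subseteq> - closure \<Omega> \<Longrightarrow> e > 0 \<Longrightarrow>
       (\<And>x. x \<in> ball x0 e \<Longrightarrow> potential h x = 0) \<Longrightarrow> mach_norm m \<omega> = 1 \<Longrightarrow>
       plane_wave_integral \<sigma> \<omega> h = 0"
    using plane_wave_integral_zero by blast
  define E where "E = (\<lambda>\<omega> y. cis (\<kappa> * (y \<bullet> m) - \<sigma> * \<kappa> * mach_inner m \<omega> y))"
  have pwE: "plane_wave_integral \<sigma> \<omega> h = (LINT y|lebesgue_on \<Omega>. E \<omega> y * h y)" for \<omega> h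
    by (simp add: plane_wave_integral_def E_def cis_mult)
  have contE: "continuous_on \<Omega> (\<lambda>y. \<kappa> * (y \<bullet> m) - \<sigma> * \<kappa> * mach_inner m \<omega> y)" for \<omega>
    unfolding mach_inner_def by (intro continuous_intros)
  have "(LINT y|lebesgue_on \<Omega>. cis (\<sigma> * \<kappa> * mach_inner m (\<omega>2 - \<omega>1) y) * q y) = 0"
    if \<omega>: "mach_norm m \<omega>1 = 1" "mach_norm m \<omega>2 = 1" for \<omega>1 \<omega>2
  proof -
    define h where "h = (\<lambda>y. cnj (E \<omega>1 y * q y))"
    have intE: "integrable (lebesgue_on \<Omega>) (\<lambda>y. E \<omega>1 y * q y)"
      unfolding E_def by (rule integrable_cis_mult[OF q contE])
    then have int: "integrable (lebesgue_on \<Omega>) h"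
      unfolding h_def by (rule integrable_cnj)
    have "potential h x2 = 0" if x2: "x2 \<in> ball x0 e" for x2
    proof -
      have "x2 \<notin> closure \<Omega>" using x2 B by blast
      then have "plane_wave_integral \<sigma> \<omega>1 (\<lambda>y. cnj (kernel x2 y) * q y) = 0"
        using zero x2 by (intro pw[OF _ B _ \<omega>(1)] integrable_kernel_mult q) (auto simp: covariance_left)
      then have "cnj (LINT y|lebesgue_on \<Omega>. E \<omega>1 y * (cnj (kernel x2 y) * q y)) = 0"
        unfolding pwE by simp
      then show ?thesis
        unfolding potential_def h_def
        by (simp add: mult_ac flip: Bochner_Integration.integral_cnj)
    qed
    then have "plane_wave_integral \<sigma> \<omega>2 h = 0"
      by (intro pw[OF int B _ \<omega>(2)])
    then have "cnj (LINT y|lebesgue_on \<Omega>. E \<omega>2 y * h y) = 0" unfolding pwE by simp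
    moreover have "cis (\<sigma> * \<kappa> * mach_inner m (\<omega>2 - \<omega>1) y) * q y = cnj (E \<omega>2 y * h y)" for y
      by (simp add: h_def E_def cis_cnj cis_mult mach_inner_simps algebra_simps flip: mult.assoc)
    ultimately show ?thesis by (simp flip: Bochner_Integration.integral_cnj)
  qed
  then show thesis using \<sigma> that by blast
qed

text \<open>In dimension at least 2 every vector of length at most 2 is the difference of two unit
  vectors.\<close>

lemma fourier_zero_small:
  assumes q: "integrable (lebesgue_on \<Omega>) q" and B: "ball x0 e \<subseteq> - closure \<Omega>" "e > 0"
    and zero: "\<And>x1 x2. x1 \<in> ball x0 e \<Longrightarrow> x2 \<in> ball x0 e \<Longrightarrow> covariance q x1 x2 = 0"
    and \<eta>: "mach_norm m \<eta> \<le> 2"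
  shows "(LINT y|lebesgue_on \<Omega>. cis (\<kappa> * mach_inner m \<eta> y) * q y) = 0"
proof -
  obtain \<sigma> where \<sigma>: "\<sigma> = 1 \<or> \<sigma> = -1" and
    pw: "\<And>\<omega>1 \<omega>2. mach_norm m \<omega>1 = 1 \<Longrightarrow> mach_norm m \<omega>2 = 1 \<Longrightarrow>
      (LINT y|lebesgue_on \<Omega>. cis (\<sigma> * \<kappa> * mach_inner m (\<omega>2 - \<omega>1) y) * q y) = 0"
    using plane_wave_products[OF q B zero] by blast
  have "2 \<le> DIM(real ^ 'a)" using dim by simp
  \<comment> \<open>Euclidean orthogonality to this vector is orthogonality to \<eta> with respect
    to \<open>mach_inner\<close>.\<close>
  then obtain u where u: "u \<noteq> 0" "orthogonal ((\<eta> \<bullet> m) *\<^sub>R m + (mach_beta m)\<^sup>2 *\<^sub>R \<eta>) u"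
    by (rule orthogonal_to_vector_exists)
  define \<nu> where "\<nu> = (1 / mach_norm m u) *\<^sub>R u"
  \<comment> \<open>Pythagoras for \<open>mach_inner\<close>: \<open>c\<close> times \<nu>, plus or
    minus half of \<eta>, is a unit vector. The bound on \<eta> keeps the radicand
    nonnegative.\<close>
  define c where "c = sqrt (1 - (mach_norm m \<eta>)\<^sup>2 / 4)"
  have un: "mach_norm m u > 0" by (rule mach_norm_pos[OF m u(1)])
  have "mach_norm m \<nu> = 1" using un by (simp add: \<nu>_def mach_norm_scale)
  then have \<nu>\<nu>: "mach_inner m \<nu> \<nu> = 1" using mach_norm_sq[of m \<nu>] by simp
  have "mach_inner m \<eta> u = 0"
    using u(2) by (simp add: mach_inner_def orthogonal_def inner_simps inner_commute)
  then have \<eta>\<nu>: "mach_inner m \<eta> \<nu> = 0" by (simp add: \<nu>_def mach_inner_simps)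
  have "(mach_norm m \<eta>)\<^sup>2 \<le> 2\<^sup>2" using \<eta> mach_norm_nonneg by (intro power_mono)
  then have c: "c\<^sup>2 = 1 - mach_inner m \<eta> \<eta> / 4" by (simp add: c_def mach_norm_sq)
  have "mach_norm m (c *\<^sub>R \<nu> + d *\<^sub>R \<eta>) = 1" if "d = 1/2 \<or> d = -1/2" for d
  proof -
    have "(mach_norm m (c *\<^sub>R \<nu> + d *\<^sub>R \<eta>))\<^sup>2 = c\<^sup>2 + d\<^sup>2 * mach_inner m \<eta> \<eta>"
      unfolding mach_norm_sq
      by (simp add: mach_inner_simps \<nu>\<nu> \<eta>\<nu> mach_inner_commute[of m \<nu> \<eta>] power2_eq_square)
    also have "d\<^sup>2 = 1 / 4" using that by (elim disjE; hypsubst; simp add: power_divide)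
    also have "c\<^sup>2 + 1 / 4 * mach_inner m \<eta> \<eta> = 1" using c by simp
    finally show ?thesis using mach_norm_nonneg by (metis power2_eq_1_iff abs_of_nonneg abs_neg_one)
  qed
  note unit = this
  have "\<sigma> * \<kappa> * (\<sigma> * x) = \<kappa> * x" for x using \<sigma> by auto
  note \<sigma>\<sigma> = this
  \<comment> \<open>The sign \<sigma> is put into the two unit vectors, so that \<sigma> squared,
    which is 1, appears in the phase.\<close>
  have diff: "(c *\<^sub>R \<nu> + (\<sigma>/2) *\<^sub>R \<eta>) - (c *\<^sub>R \<nu> + (-\<sigma>/2) *\<^sub>R \<eta>) = \<sigma> *\<^sub>R \<eta>"
    by (simp flip: scaleR_add_left)
  have "(LINT y|lebesgue_on \<Omega>. cis (\<sigma> * \<kappa> * mach_inner m ((c *\<^sub>R \<nu> + (\<sigma>/2) *\<^sub>R \<eta>) - (c *\<^sub>R \<nu> + (-\<sigma>/2) *\<^sub>R \<eta>)) y) * q y) = 0"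
    using \<sigma> by (intro pw unit) auto
  then show ?thesis unfolding diff mach_inner_simps(5) \<sigma>\<sigma> .
qed

text \<open>Along the ray through \<eta> the Fourier integral is holomorphic in the parameter
  because \<Omega> is bounded; it vanishes for small positive parameters by
  \<open>fourier_zero_small\<close>, hence at 1. The disc of radius 2 contains 1 and still gives a
  uniform bound on the integrand's exponential.\<close>

lemma fourier_zero:
  assumes q: "integrable (lebesgue_on \<Omega>) q" and B: "ball x0 e \<subseteq> - closure \<Omega>" "e > 0"
    and zero: "\<And>x1 x2. x1 \<in> ball x0 e \<Longrightarrow> x2 \<in> ball x0 e \<Longrightarrow> covariance q x1 x2 = 0"
  shows "(LINT y|lebesgue_on \<Omega>. cis (\<kappa> * mach_inner m \<eta> y) * q y) = 0"
proof -
  define F where "F = (\<lambda>t. LINT y|lebesgue_on \<Omega>. exp (\<i> * t * of_real (\<kappa> * mach_inner m \<eta> y)) * q y)"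
  have cont: "continuous_on S (\<lambda>y. \<kappa> * mach_inner m \<eta> y)" for S
    unfolding mach_inner_def by (intro continuous_intros)
  have "compact ((\<lambda>y. \<kappa> * mach_inner m \<eta> y) ` closure \<Omega>)"
    using \<Omega> by (intro compact_continuous_image cont) auto
  then obtain D where "\<forall>z\<in>(\<lambda>y. \<kappa> * mach_inner m \<eta> y) ` closure \<Omega>. norm z \<le> D"
    using compact_imp_bounded bounded_iff by metis
  then have D: "\<bar>\<kappa> * mach_inner m \<eta> y\<bar> \<le> D" if "y \<in> \<Omega>" for y
    using that closure_subset[of \<Omega>] by auto
  have "F holomorphic_on ball 0 2"
    unfolding F_def
  proof (rule holomorphic_on_integral_kernel[OF open_ball q])
    fix t :: complex assume t: "t \<in> ball 0 2"
    show "(\<lambda>y. exp (\<i> * t * of_real (\<kappa> * mach_inner m \<eta> y))) \<in> borel_measurable (lebesgue_on \<Omega>)"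
      using \<Omega>(1) by (intro measurable_lebesgue_on_continuous continuous_intros cont)
    show "cmod (exp (\<i> * t * of_real (\<kappa> * mach_inner m \<eta> y))) \<le> exp (2 * D)"
      if "y \<in> space (lebesgue_on \<Omega>)" for y
    proof -
      have "cmod (exp (\<i> * t * of_real (\<kappa> * mach_inner m \<eta> y))) \<le> exp (cmod (\<i> * t * of_real (\<kappa> * mach_inner m \<eta> y)))"
        by (rule norm_exp)
      also have "cmod (\<i> * t * of_real (\<kappa> * mach_inner m \<eta> y)) = cmod t * \<bar>\<kappa> * mach_inner m \<eta> y\<bar>"
        by (simp add: norm_mult flip: of_real_mult)
      also have "\<dots> \<le> 2 * D" using t D that by (intro mult_mono) auto
      finally show ?thesis by simp
    qed
  qed (intro holomorphic_intros)
  moreover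
  define \<delta> where "\<delta> = min 1 (2 / (mach_norm m \<eta> + 1))"
  have \<eta>1: "mach_norm m \<eta> + 1 > 0" using mach_norm_nonneg[of m \<eta>] by linarith
  then have \<delta>: "\<delta> > 0" by (simp add: \<delta>_def)
  have F_real: "F (of_real t) = (LINT y|lebesgue_on \<Omega>. cis (\<kappa> * mach_inner m (t *\<^sub>R \<eta>) y) * q y)" for t
    by (simp add: F_def cis_conv_exp mach_inner_simps mult_ac)
  have F0: "F (of_real t) = 0" if "0 < t" "t < \<delta>" for t
    unfolding F_real
  proof (rule fourier_zero_small[OF q B zero])
    have "mach_norm m (t *\<^sub>R \<eta>) = t * mach_norm m \<eta>" using that by (simp add: mach_norm_scale)
    also have "\<dots> \<le> 2 / (mach_norm m \<eta> + 1) * (mach_norm m \<eta> + 1)"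
      using that \<eta>1 mach_norm_nonneg[of m \<eta>] by (intro mult_mono) (auto simp: \<delta>_def)
    also have "\<dots> = 2" using \<eta>1 by (metis less_irrefl nonzero_divide_eq_eq)
    finally show "mach_norm m (t *\<^sub>R \<eta>) \<le> 2" .
  qed
  have "F 1 = 0"
  proof (rule analytic_continuation[OF \<open>F holomorphic_on ball 0 2\<close> open_ball connected_ball])
    show "complex_of_real ` {0<..<\<delta>} \<subseteq> ball 0 2" by (auto simp: \<delta>_def)
    show "0 islimpt complex_of_real ` {0<..<\<delta>}"
      unfolding islimpt_approachable
    proof (intro allI impI)
      fix d :: real assume "d > 0"
      then show "\<exists>x'\<in>complex_of_real ` {0<..<\<delta>}. x' \<noteq> 0 \<and> dist x' 0 < d"
        using \<delta> by (intro bexI[of _ "of_real (min (\<delta>/2) (d/2))"]) (auto simp: dist_norm)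
    qed
    show "F \<tau> = 0" if "\<tau> \<in> complex_of_real ` {0<..<\<delta>}" for \<tau> using F0 that by auto
  qed auto
  then show ?thesis using F_real[of 1] by simp
qed

lemma covariance_zero_imp_AE_zero:
  assumes q: "integrable (lebesgue_on \<Omega>) q" and B: "ball x0 e \<subseteq> - closure \<Omega>" "e > 0"
    and zero: "\<And>x1 x2. x1 \<in> ball x0 e \<Longrightarrow> x2 \<in> ball x0 e \<Longrightarrow> covariance q x1 x2 = 0"
  shows "AE y in lebesgue_on \<Omega>. q y = 0"
proof (rule fourier_uniqueness[OF \<Omega> q])
  fix \<xi> :: "real ^ 'a"
  \<comment> \<open>Solves \<open>\<kappa> * mach_inner m \<eta> y = \<xi> \<bullet> y\<close> for
    all \<open>y\<close>: as \<open>beta^2 = 1 - |m|^2\<close>, the matrix of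
    \<open>mach_inner\<close> has the inverse \<open>(I - m m^T) / beta^2\<close>. Thus every
    frequency \<xi> is reached.\<close>
  define \<eta> where "\<eta> = (1 / ((mach_beta m)\<^sup>2 * \<kappa>)) *\<^sub>R (\<xi> - (\<xi> \<bullet> m) *\<^sub>R m)"
  have "(mach_beta m)\<^sup>2 * (\<kappa> * mach_inner m \<eta> y) = (mach_beta m)\<^sup>2 * (\<xi> \<bullet> y)" for y
  proof -
    have "(mach_beta m)\<^sup>2 * (\<kappa> * mach_inner m \<eta> y) = mach_inner m (\<xi> - (\<xi> \<bullet> m) *\<^sub>R m) y"
      using \<kappa> mach_beta_pos[OF m] by (simp add: \<eta>_def mach_inner_simps(5))
    also have "\<dots> = (mach_beta m)\<^sup>2 * (\<xi> \<bullet> y)"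
      unfolding mach_inner_def mach_beta_sq[OF m] power2_norm_eq_inner
      by (simp add: inner_simps inner_commute algebra_simps)
    finally show ?thesis .
  qed
  then have "\<kappa> * mach_inner m \<eta> y = \<xi> \<bullet> y" for y
    using mach_beta_pos[OF m] by simp
  then show "(LINT y|lebesgue_on \<Omega>. cis (\<xi> \<bullet> y) * q y) = 0"
    using fourier_zero[OF q B zero, of \<eta>] by simp
qed

lemma covariance_diff:
  assumes "integrable (lebesgue_on \<Omega>) q1" "integrable (lebesgue_on \<Omega>) q2"
    "x1 \<notin> closure \<Omega>" "x2 \<notin> closure \<Omega>"
  shows "covariance (\<lambda>y. q1 y - q2 y) x1 x2 = covariance q1 x1 x2 - covariance q2 x1 x2"
  unfolding covariance_left potential_def right_diff_distrib
  by (intro Bochner_Integration.integral_diff integrable_kernel_mult assms)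

lemma continuous_on_covariance:
  assumes "integrable (lebesgue_on \<Omega>) q" "compact S" "S \<inter> closure \<Omega> = {}" "x \<notin> closure \<Omega>"
  shows "continuous_on S (\<lambda>z. covariance q z x)" "continuous_on S (covariance q x)"
proof -
  show "continuous_on S (\<lambda>z. covariance q z x)"
    unfolding covariance_left by (intro continuous_on_potential integrable_kernel_mult assms)
  show "continuous_on S (covariance q x)"
    unfolding covariance_right[abs_def]
    by (intro continuous_on_cnj continuous_on_potential integrable_cnj integrable_kernel_mult assms)
qed

lemma covariance_bounded:
  assumes "integrable (lebesgue_on \<Omega>) q" "compact S" "S \<inter> closure \<Omega> = {}"
  obtains D where "\<And>x1 x2. x1 \<in> S \<Longrightarrow> x2 \<in> S \<Longrightarrow> cmod (covariance q x1 x2) \<le> D"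
proof -
  obtain B where B: "\<And>x y. x \<in> S \<Longrightarrow> y \<in> \<Omega> \<Longrightarrow> cmod (kernel x y) \<le> B"
    using kernel_bounded[OF assms(2,3)] by blast
  have "cmod (covariance q x1 x2) \<le> (LINT y|lebesgue_on \<Omega>. B * B * cmod (q y))"
    if "x1 \<in> S" "x2 \<in> S" for x1 x2
  proof -
    have "x1 \<notin> closure \<Omega>" "x2 \<notin> closure \<Omega>" using that assms(3) by auto
    then have "integrable (lebesgue_on \<Omega>) (\<lambda>y. kernel x1 y * (cnj (kernel x2 y) * q y))"
      by (intro integrable_kernel_mult assms)
    then have "cmod (LINT y|lebesgue_on \<Omega>. kernel x1 y * (cnj (kernel x2 y) * q y)) \<le> (LINT y|lebesgue_on \<Omega>. B * B * cmod (q y))"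
    proof (intro order.trans[OF integral_norm_bound integral_mono] integrable_norm)
      fix y assume "y \<in> space (lebesgue_on \<Omega>)"
      then have "cmod (kernel x1 y) * cmod (kernel x2 y) \<le> B * B"
        using B that by (intro mult_mono) (auto intro: order.trans[OF norm_ge_zero])
      then show "cmod (kernel x1 y * (cnj (kernel x2 y) * q y)) \<le> B * B * cmod (q y)"
        using mult_right_mono[of _ _ "cmod (q y)"] by (simp add: norm_mult flip: mult.assoc)
    qed (use assms in simp_all)
    then show ?thesis by (simp add: covariance_left potential_def)
  qed
  then show thesis using that by blast
qed

text \<open>Testing the operator with the conjugated kernel \<open>z \<mapsto> covariance q x z\<close>, cut off to a ball,
  and evaluating at \<open>x\<close>, which the continuity of the result in the evaluation point allows.\<close>

lemma operator_injective:
  assumes q1: "q1 \<in> Linf_fun \<Omega>" and q2: "q2 \<in> Linf_fun \<Omega>"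
    and M: "open M" "bounded M" "M \<noteq> {}" "M \<subseteq> - closure \<Omega>"
    and eq: "\<forall>\<phi>\<in>L2_fun M. AE x in lebesgue_on M.
       (LINT z|lebesgue_on M. covariance q1 x z * \<phi> z) = (LINT z|lebesgue_on M. covariance q2 x z * \<phi> z)"
  shows "AE y in lebesgue_on \<Omega>. q1 y = q2 y"
proof -
  have lm: "\<Omega> \<in> lmeasurable" "M \<in> lmeasurable"
    using \<Omega> M lmeasurable_open by blast+
  note int = Linf_fun_integrable[OF q1 lm(1)] Linf_fun_integrable[OF q2 lm(1)]
  define q where "q = (\<lambda>y. q1 y - q2 y)"
  have q: "integrable (lebesgue_on \<Omega>) q" unfolding q_def using int by simp
  obtain x0 e where e: "e > 0" "cball x0 e \<subseteq> M"
    using M(1,3) open_contains_cball by blast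
  \<comment> \<open>The compact ball \<open>S\<close> supplies bounds and integrability; its
    interior \<open>B\<close> is open, as \<open>continuous_AE_zero\<close> requires.\<close>
  define S B where "S = cball x0 e" and "B = ball x0 e"
  have S: "compact S" "S \<inter> closure \<Omega> = {}" and SM: "S \<subseteq> M" and BS: "B \<subseteq> S"
    using e M(4) ball_subset_cball by (auto simp: S_def B_def)
  have B: "open B" and BM: "B \<subseteq> M"
    using SM BS by (auto simp: B_def)
  interpret fM: finite_measure "lebesgue_on M"
    using lm(2) by (simp add: finite_measure_lebesgue_on)
  have cut_meas: "(\<lambda>z. indicator B z * f z) \<in> borel_measurable (lebesgue_on M)"
    if "continuous_on S f" for f :: "real ^ 'a \<Rightarrow> complex"
  proof -
    have "continuous_on B f" using that BS by (rule continuous_on_subset)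
    then have "(\<lambda>z. if z \<in> B then f z else 0) \<in> borel_measurable lebesgue"
      using B by (intro borel_measurable_if_I measurable_lebesgue_on_continuous) auto
    then have "(\<lambda>z. indicator B z * f z) \<in> borel_measurable lebesgue"
      by (rule measurable_cong[THEN iffD1, rotated]) (auto simp: indicator_def)
    then show ?thesis by (rule measurable_restrict_space1)
  qed
  have cut_bound: "\<exists>D. \<forall>z. cmod (indicator B z * f z) \<le> D"
    if "continuous_on S f" for f :: "real ^ 'a \<Rightarrow> complex"
  proof -
    have "compact (f ` S)" using that S(1) by (rule compact_continuous_image)
    then obtain D where "\<forall>z\<in>f ` S. cmod z \<le> D"
      using compact_imp_bounded bounded_iff by metis
    then have "cmod (indicator B z * f z) \<le> max 0 D" for z
      using BS by (auto simp: indicator_def le_max_iff_disj)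
    then show ?thesis by blast
  qed
  have cut_int: "integrable (lebesgue_on M) (\<lambda>z. indicator B z * f z)"
    if "continuous_on S f" for f :: "real ^ 'a \<Rightarrow> complex"
    using cut_meas[OF that] cut_bound[OF that] by (auto intro: fM.integrable_const_bound)
  have "covariance q x z = 0" if x: "x \<in> B" and z: "z \<in> B" for x z
  proof -
    define \<phi> where "\<phi> = (\<lambda>z. indicator B z * cnj (covariance q x z))"
    have xc: "x \<notin> closure \<Omega>" using x BS S(2) by blast
    have cov_cont: "continuous_on S (covariance q x)"
      by (rule continuous_on_covariance(2)[OF q S xc])
    then have ccont: "continuous_on S (\<lambda>z. cnj (covariance q x z))" by (intro continuous_intros)
    have \<phi>_int: "integrable (lebesgue_on M) \<phi>" unfolding \<phi>_def by (rule cut_int[OF ccont])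
    have "\<phi> \<in> L2_fun M"
    proof -
      obtain D where D: "\<And>z. cmod (\<phi> z) \<le> D" using cut_bound[OF ccont] by (auto simp: \<phi>_def)
      have "(\<lambda>z. (cmod (\<phi> z))\<^sup>2) \<in> borel_measurable (lebesgue_on M)"
        using borel_measurable_integrable[OF \<phi>_int] by measurable
      moreover have "norm ((cmod (\<phi> z))\<^sup>2) \<le> D\<^sup>2" for z
        using D[of z] by (simp add: power_mono)
      ultimately have "integrable (lebesgue_on M) (\<lambda>z. (cmod (\<phi> z))\<^sup>2)"
        by (intro fM.integrable_const_bound[of _ "D\<^sup>2"]) auto
      then show ?thesis using borel_measurable_integrable[OF \<phi>_int] by (simp add: L2_fun_def)
    qed
    \<comment> \<open>For \<open>w\<close> in \<open>B\<close> this is the difference of the two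
      operators applied to \<phi>. The second indicator agrees with the one in \<phi> and makes the
      kernel bounded and continuous in \<open>w\<close> for every \<open>z\<close>.\<close>
    define F where "F = (\<lambda>w. LINT z|lebesgue_on M. (indicator B z * covariance q w z) * \<phi> z)"
    have F_AE: "AE w in lebesgue_on M. w \<in> B \<longrightarrow> F w = 0"
      using eq[rule_format, OF \<open>\<phi> \<in> L2_fun M\<close>]
    proof eventually_elim
      case (elim w)
      show ?case
      proof
        assume "w \<in> B"
        then have w: "w \<notin> closure \<Omega>" using BS S(2) by blast
        have i: "integrable (lebesgue_on M) (\<lambda>z. covariance q' w z * \<phi> z)"
          if "integrable (lebesgue_on \<Omega>) q'" for q'
        proof -
          have "continuous_on S (\<lambda>z. covariance q' w z * cnj (covariance q x z))"
            by (intro continuous_on_mult ccont continuous_on_covariance(2)[OF that S w])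
          from cut_int[OF this] show ?thesis by (simp add: \<phi>_def mult_ac)
        qed
        have "(indicator B z * covariance q w z) * \<phi> z = covariance q1 w z * \<phi> z - covariance q2 w z * \<phi> z" for z
        proof (cases "z \<in> B")
          case True
          then have "z \<notin> closure \<Omega>" using BS S(2) by blast
          then show ?thesis
            using True covariance_diff[OF int w] by (simp add: q_def left_diff_distrib)
        qed (simp add: \<phi>_def)
        then show "F w = 0"
          unfolding F_def using elim Bochner_Integration.integral_diff[OF i[OF int(1)] i[OF int(2)]] by simp
      qed
    qed
    obtain D where D: "\<And>x1 x2. x1 \<in> S \<Longrightarrow> x2 \<in> S \<Longrightarrow> cmod (covariance q x1 x2) \<le> D"
      using covariance_bounded[OF q S] by blast
    have contF: "continuous_on B F"
      unfolding F_def
    proof (rule continuous_on_integral_kernel[OF \<phi>_int])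
      fix w assume w: "w \<in> B"
      then have wc: "w \<notin> closure \<Omega>" using BS S(2) by blast
      show "(\<lambda>z. indicator B z * covariance q w z) \<in> borel_measurable (lebesgue_on M)"
        by (intro cut_meas continuous_on_covariance(2)[OF q S wc])
      show "cmod (indicator B z * covariance q w z) \<le> max 0 D" for z
        using D[of w z] w BS by (auto simp: indicator_def le_max_iff_disj)
    next
      fix z
      show "continuous_on B (\<lambda>w. indicator B z * covariance q w z)"
      proof (cases "z \<in> B")
        case True
        then have "z \<notin> closure \<Omega>" using BS S(2) by blast
        then show ?thesis
          using continuous_on_subset[OF continuous_on_covariance(1)[OF q S] BS] by (intro continuous_intros)
      qed simp
    qed
    have "F x = 0"
      by (rule continuous_AE_zero[OF B BM _ contF F_AE x]) (use lm(2) in auto)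
    \<comment> \<open>At \<open>w = x\<close> the integrand is a squared modulus, so what vanishes
      is the squared norm of \<open>covariance q x\<close> on \<open>B\<close>.\<close>
    moreover have "(indicator B z * covariance q x z) * \<phi> z = of_real (indicator B z * (cmod (covariance q x z))\<^sup>2)" for z
      unfolding \<phi>_def
      by (cases "z \<in> B") (simp_all add: complex_norm_square del: of_real_power)
    ultimately have "(LINT z|lebesgue_on M. complex_of_real (indicator B z * (cmod (covariance q x z))\<^sup>2)) = 0"
      by (simp add: F_def)
    then have z0: "(LINT z|lebesgue_on M. indicator B z * (cmod (covariance q x z))\<^sup>2) = 0"
      by (simp only: integral_complex_of_real of_real_eq_0_iff)
    have "integrable (lebesgue_on M) (\<lambda>z. indicator B z * complex_of_real ((cmod (covariance q x z))\<^sup>2))"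
      by (intro cut_int continuous_intros cov_cont)
    then have "integrable (lebesgue_on M) (\<lambda>z. Re (indicator B z * complex_of_real ((cmod (covariance q x z))\<^sup>2)))"
      by (rule integrable_Re)
    also have "(\<lambda>z. Re (indicator B z * complex_of_real ((cmod (covariance q x z))\<^sup>2))) = (\<lambda>z. indicator B z * (cmod (covariance q x z))\<^sup>2)"
      by (auto simp: indicator_def)
    finally have "AE z in lebesgue_on M. indicator B z * (cmod (covariance q x z))\<^sup>2 = 0"
      using z0 by (subst (asm) integral_nonneg_eq_0_iff_AE) auto
    then have cov_AE: "AE z in lebesgue_on M. z \<in> B \<longrightarrow> covariance q x z = 0"
      by eventually_elim auto
    show ?thesis
      by (rule continuous_AE_zero[OF B BM _ continuous_on_subset[OF cov_cont BS] cov_AE z])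
        (use lm(2) in auto)
  qed
  then have "AE y in lebesgue_on \<Omega>. q y = 0"
    using covariance_zero_imp_AE_zero[OF q, of x0 e] e(1) S(2) BS unfolding B_def by blast
  then show ?thesis by eventually_elim (simp add: q_def)
qed

end

section \<open>The Green's functions of dimensions 3 and 2 as scattering kernels\<close>

lemma scattering_kernel_green3:
  fixes m :: "real ^ 'n"
  assumes "CARD('n) = 3" "\<kappa> > 0" "norm m < 1" "open \<Omega>" "bounded \<Omega>" "connected (- closure \<Omega>)"
  shows "scattering_kernel m \<kappa> (\<lambda>w. exp (\<i> * of_real \<kappa> * csqrt w) / (4 * of_real pi * csqrt w)) \<Omega>
    1 (1 / (4 * of_real pi)) 0"
proof unfold_locales
  \<comment> \<open>For positive \<open>s\<close>, \<open>csqrt\<close> of \<open>s^2\<close> is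
    \<open>s\<close>; the asymptotics are thus an identity, purely outgoing.\<close>
  let ?G = "\<lambda>w. exp (\<i> * of_real \<kappa> * csqrt w) / (4 * of_real pi * csqrt w)"
  have *: "w \<notin> \<real>\<^sub>\<le>\<^sub>0" if "0 < Re w" for w using that by (auto simp: complex_nonpos_Reals_iff)
  show "?G holomorphic_on {z. 0 < Re z}"
    by (intro holomorphic_intros) (use * in auto)
  have "\<forall>\<^sub>F s in at_top. complex_of_real (s powr 1) * ?G (of_real (s\<^sup>2))
      - (1 / (4 * of_real pi) * cis (\<kappa> * s) + 0 * cis (- \<kappa> * s)) = 0"
    using eventually_gt_at_top[of 0]
    by eventually_elim (simp add: cis_conv_exp mult_ac flip: of_real_power)
  then show "((\<lambda>s. complex_of_real (s powr 1) * ?G (of_real (s\<^sup>2))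
      - (1 / (4 * of_real pi) * cis (\<kappa> * s) + 0 * cis (- \<kappa> * s))) \<longlongrightarrow> 0) at_top"
    by (rule tendsto_eventually)
qed (use assms in auto)

lemma scattering_kernel_green2:
  fixes m :: "real ^ 'n"
  assumes "CARD('n) = 2" "\<kappa> > 0" "norm m < 1" "open \<Omega>" "bounded \<Omega>" "connected (- closure \<Omega>)"
  obtains a b where
    "scattering_kernel m \<kappa> (\<lambda>w. \<i> / of_real (4 * mach_beta m) * hankel_sq (of_real (\<kappa>\<^sup>2 / 4) * w)) \<Omega> (1/2) a b"
proof -
  obtain a b where ab: "((\<lambda>r. of_real (sqrt r) * hankel1_0 r - (a * cis r + b * cis (- r))) \<longlongrightarrow> 0) at_top"
    "a \<noteq> 0 \<or> b \<noteq> 0" using hankel1_0_asymptotics by blast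
  \<comment> \<open>The prefactor of the Green's function divided by \<open>sqrt \<kappa>\<close>,
    because the Hankel asymptotics come with the weight \<open>sqrt (\<kappa> * s)\<close> instead
    of \<open>s powr (1/2)\<close>.\<close>
  define c where "c = \<i> / of_real (4 * mach_beta m * sqrt \<kappa>)"
  let ?G = "\<lambda>w. \<i> / of_real (4 * mach_beta m) * hankel_sq (of_real (\<kappa>\<^sup>2 / 4) * w)"
  have c: "c \<noteq> 0" using mach_beta_pos[OF assms(3)] assms(2) by (simp add: c_def)
  have "scattering_kernel m \<kappa> ?G \<Omega> (1/2) (c * a) (c * b)"
  proof unfold_locales
    have *: "of_real (\<kappa>\<^sup>2 / 4) * w \<notin> \<real>\<^sub>\<le>\<^sub>0" if "0 < Re w" for w
    proof -
      have "0 < Re (of_real (\<kappa>\<^sup>2 / 4) * w)" using that assms(2) by simp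
      then show ?thesis by (auto simp: complex_nonpos_Reals_iff)
    qed
    have H: "hankel_sq holomorphic_on (- \<real>\<^sub>\<le>\<^sub>0)"
      using hankel_sq_deriv(1) by (auto simp: holomorphic_on_open open_Compl)
    have "(hankel_sq \<circ> (\<lambda>w. of_real (\<kappa>\<^sup>2 / 4) * w)) holomorphic_on {z. 0 < Re z}"
      by (rule holomorphic_on_compose_gen[OF _ H]) (use * in \<open>auto intro!: holomorphic_intros\<close>)
    then show "?G holomorphic_on {z. 0 < Re z}"
      unfolding o_def by (intro holomorphic_intros)
    have "((\<lambda>s. c * (of_real (sqrt (\<kappa> * s)) * hankel1_0 (\<kappa> * s) - (a * cis (\<kappa> * s) + b * cis (- (\<kappa> * s))))) \<longlongrightarrow> 0) at_top"
    proof (rule tendsto_mult_right_zero)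
      have "filterlim (\<lambda>s. \<kappa> * s) at_top at_top" using assms(2) by real_asymp
      from filterlim_compose[OF ab(1) this]
      show "((\<lambda>s. of_real (sqrt (\<kappa> * s)) * hankel1_0 (\<kappa> * s) - (a * cis (\<kappa> * s) + b * cis (- (\<kappa> * s)))) \<longlongrightarrow> 0) at_top" .
    qed
    moreover have "\<forall>\<^sub>F s in at_top. c * (of_real (sqrt (\<kappa> * s)) * hankel1_0 (\<kappa> * s) - (a * cis (\<kappa> * s) + b * cis (- (\<kappa> * s))))
        = of_real (s powr (1/2)) * ?G (of_real (s\<^sup>2)) - (c * a * cis (\<kappa> * s) + c * b * cis (- \<kappa> * s))"
      using eventually_gt_at_top[of 0]
    proof eventually_elim
      case (elim s)
      have "hankel1_0 (\<kappa> * s) = hankel_sq (of_real (\<kappa>\<^sup>2 / 4) * of_real (s\<^sup>2))"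
        using assms(2) elim by (simp add: hankel1_0_eq power_mult_distrib power_divide)
      moreover have "c * of_real (sqrt (\<kappa> * s)) = of_real (s powr (1/2)) * (\<i> / of_real (4 * mach_beta m))"
        using assms(2) elim mach_beta_pos[OF assms(3)]
        by (simp add: c_def powr_half_sqrt real_sqrt_mult field_simps)
      ultimately show ?case by (simp add: right_diff_distrib distrib_left flip: mult.assoc)
    qed
    ultimately show "((\<lambda>s. of_real (s powr (1/2)) * ?G (of_real (s\<^sup>2)) - (c * a * cis (\<kappa> * s) + c * b * cis (- \<kappa> * s))) \<longlongrightarrow> 0) at_top"
      by (rule Lim_transform_eventually)
    show "c * a \<noteq> 0 \<or> c * b \<noteq> 0" using ab(2) c by simp
  qed (use assms in auto)
  then show thesis by (rule that)
qed

theorem theorem3p6: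
  fixes k :: real and m :: "real ^ 'n"
    and \<Omega> M :: "(real ^ 'n) set"
    and q1 q2 :: "real ^ 'n \<Rightarrow> complex"
  assumes "CARD('n) \<in> {2, 3}"
    and "open \<Omega>" and "connected \<Omega>" and "bounded \<Omega>" and "0 \<in> \<Omega>"
    and "connected (- closure \<Omega>)"
    and "open M" and "connected M" and "bounded M" and "M \<noteq> {}"
    and "M \<subseteq> - closure \<Omega>"
    and "k > 0" and "norm m < 1"
    and "q1 \<in> Linf_fun \<Omega>" and "q2 \<in> Linf_fun \<Omega>"
    and "\<forall>\<phi>\<in>L2_fun M. AE x in lebesgue_on M.
           cov_operator k m \<Omega> M q1 \<phi> x = cov_operator k m \<Omega> M q2 \<phi> x"
  shows "AE x in lebesgue_on \<Omega>. q1 x = q2 x"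
proof -
  define \<kappa> where "\<kappa> = k / (mach_beta m)\<^sup>2"
  note \<beta> = mach_beta_pos[OF \<open>norm m < 1\<close>]
  have \<kappa>: "\<kappa> > 0" using \<open>k > 0\<close> \<beta> by (simp add: \<kappa>_def)
  \<comment> \<open>The identity is stated for \<open>x \<noteq> y\<close>, the only pairs that
    occur in the covariance: \<open>M\<close> and \<Omega> are disjoint.\<close>
  obtain G p a b where sc: "scattering_kernel m \<kappa> G \<Omega> p a b"
    and green: "\<And>x y. x \<noteq> y \<Longrightarrow>
      convected_green k m x y = cis (- \<kappa> * ((x - y) \<bullet> m)) * G (of_real ((mach_norm m (x - y))\<^sup>2))"
  proof (cases "CARD('n) = 3")
    case True
    let ?G = "\<lambda>w. exp (\<i> * of_real \<kappa> * csqrt w) / (4 * of_real pi * csqrt w)"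
    have "convected_green k m x y = cis (- \<kappa> * ((x - y) \<bullet> m)) * ?G (of_real ((mach_norm m (x - y))\<^sup>2))" for x y
    proof -
      have "csqrt (of_real ((mach_norm m (x - y))\<^sup>2)) = of_real (mach_norm m (x - y))"
        using mach_norm_nonneg[of m "x - y"] by (simp flip: of_real_power)
      moreover have "exp (\<i> * complex_of_real (\<kappa> * (- ((x - y) \<bullet> m) + r)))
          = cis (- \<kappa> * ((x - y) \<bullet> m)) * exp (\<i> * of_real \<kappa> * of_real r)" for r
        unfolding cis_conv_exp exp_add[symmetric] by (simp add: distrib_left right_diff_distrib mult.assoc)
      ultimately show ?thesis
        unfolding convected_green_def \<kappa>_def[symmetric] using True by simp
    qed
    then show thesis using that[OF scattering_kernel_green3] True assms \<kappa> by blast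
  next
    case False
    then have 2: "CARD('n) = 2" using assms(1) by simp
    let ?G = "\<lambda>w. \<i> / of_real (4 * mach_beta m) * hankel_sq (of_real (\<kappa>\<^sup>2 / 4) * w)"
    have "convected_green k m x y = cis (- \<kappa> * ((x - y) \<bullet> m)) * ?G (of_real ((mach_norm m (x - y))\<^sup>2))"
      if "x \<noteq> y" for x y
    proof -
      have "0 < \<kappa> * mach_norm m (x - y)" using \<kappa> mach_norm_pos[OF \<open>norm m < 1\<close>] that by simp
      then have "hankel1_0 (\<kappa> * mach_norm m (x - y)) = hankel_sq (of_real (\<kappa>\<^sup>2 / 4) * of_real ((mach_norm m (x - y))\<^sup>2))"
        by (simp add: hankel1_0_eq power_mult_distrib power_divide)
      moreover have "exp (- \<i> * complex_of_real (\<kappa> * ((x - y) \<bullet> m))) = cis (- \<kappa> * ((x - y) \<bullet> m))"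
        by (simp add: cis_conv_exp)
      ultimately show ?thesis
        unfolding convected_green_def \<kappa>_def[symmetric] using 2 by (simp only: if_False mult_ac) simp
    qed
    moreover obtain a b where "scattering_kernel m \<kappa> ?G \<Omega> (1/2) a b"
      using scattering_kernel_green2[OF 2 \<kappa>] assms by blast
    ultimately show thesis using that by blast
  qed
  interpret scattering_kernel m \<kappa> G \<Omega> p a b by (rule sc)
  have cov: "cov_kernel k m \<Omega> q x1 x2 = covariance q x1 x2" if "x1 \<in> M" "x2 \<in> M" for q x1 x2
  proof -
    have "x1 \<notin> \<Omega>" "x2 \<notin> \<Omega>" using that assms(11) closure_subset[of \<Omega>] by auto
    then have "convected_green k m x1 y = kernel x1 y" "convected_green k m x2 y = kernel x2 y" if "y \<in> \<Omega>" for y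
      using that green kernel_def by metis+
    then show ?thesis
      unfolding cov_kernel_def covariance_def by (intro Bochner_Integration.integral_cong) auto
  qed
  have op: "cov_operator k m \<Omega> M q \<phi> x = (LINT z|lebesgue_on M. covariance q x z * \<phi> z)"
    if "x \<in> M" for q \<phi> x
    unfolding cov_operator_def using cov that
    by (intro Bochner_Integration.integral_cong) (auto simp: space_restrict_space)
  show ?thesis
  proof (rule operator_injective[OF assms(14,15,7,9,10,11)])
    show "\<forall>\<phi>\<in>L2_fun M. AE x in lebesgue_on M.
       (LINT z|lebesgue_on M. covariance q1 x z * \<phi> z) = (LINT z|lebesgue_on M. covariance q2 x z * \<phi> z)"
    proof
      fix \<phi> assume "\<phi> \<in> L2_fun M"
      then have "AE x in lebesgue_on M. cov_operator k m \<Omega> M q1 \<phi> x = cov_operator k m \<Omega> M q2 \<phi> x"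
        using assms(16) by blast
      then show "AE x in lebesgue_on M. (LINT z|lebesgue_on M. covariance q1 x z * \<phi> z) = (LINT z|lebesgue_on M. covariance q2 x z * \<phi> z)"
        using AE_space by eventually_elim (use op in \<open>auto simp: space_restrict_space\<close>)
    qed
  qed
qed

end
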